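(* Let $G$ be a hyperbolic group with finite generating set $X$ and let $H$ be a quasiconvex subgroup of $G$. Then $\mathrm{ConjGeo}_X(H)$ and $\mathrm{ConjMinLenSL}_X(H)$ are regular languages.
   Context: Let $G$ be a group with finite generating set $X\subseteq G$, let $\widetilde X=X\cup X^{-1}$ and let $\pi:\widetilde X^*\to G$ be the canonical surjective monoid homomorphism. For $g\in G$, $|g|$ is the length of a shortest word over $\widetilde X$ representing $g$, and $|g|_c=\min\{|h| : h \text{ conjugate to } g\}$; $\ell(w)$ is the length of a word $w$. Fix a total order on $\widetilde X$; $w_g$ denotes the shortlex-least word in $\widetilde X^*$ representing $g$. For $U\subseteq G$ put $\alpha(U)=\bigcup_{g\in G}g^{-1}Ug$, and $$\mathrm{ConjGeo}_X(U)=\{w\in\widetilde X^* : \ell(w)=|w\pi|_c \text{ and } w\pi\in\alpha(U)\},$$ $$\mathrm{ConjMinLenSL}_X(U)=\{w_g : g\in\alpha(U),\ |g|=|g|_c\}.$$ A group is hyperbolic if for some $\delta\ge 0$ every geodesic triangle in its Cayley graph has each side contained in the $\delta$-neighbourhood of the union of the other two sides. A subgroup $H$ of a hyperbolic group $G$ is quasiconvex if there is a constant $k\ge0$ such that every geodesic in the Cayley graph of $G$ with endpoints in $H$ lies within distance $k$ of $H$. *)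

theory Defs
  imports "HOL-Algebra.Generated_Groups" "Graph_Theory.Arc_Walk"
begin

section \<open>Regular languages\<close>

text \<open>Recognition by a finite deterministic automaton. Taking the states to be natural numbers is
  no restriction, since the states of a finite automaton can be renamed.\<close>

definition regular_language :: "'a set \<Rightarrow> 'a list set \<Rightarrow> bool" where
  "regular_language A L \<longleftrightarrow> finite A \<and>
     (\<exists>(Q :: nat set) q0 \<tau> F. finite Q \<and> q0 \<in> Q \<and> F \<subseteq> Q \<and>
        (\<forall>q\<in>Q. \<forall>a\<in>A. \<tau> q a \<in> Q) \<and>
        L = {w \<in> lists A. foldl \<tau> q0 w \<in> F})"


section \<open>Words over a generating set\<close>

definition letters :: "('a, 'b) monoid_scheme \<Rightarrow> 'a set \<Rightarrow> 'a set" where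
  "letters G X = X \<union> m_inv G ` X"

text \<open>The canonical monoid homomorphism (written $\pi$ in the literature).\<close>

definition word_value :: "('a, 'b) monoid_scheme \<Rightarrow> 'a list \<Rightarrow> 'a" where
  "word_value G w = foldr (\<lambda>x y. x \<otimes>\<^bsub>G\<^esub> y) w \<one>\<^bsub>G\<^esub>"

definition representatives :: "('a, 'b) monoid_scheme \<Rightarrow> 'a set \<Rightarrow> 'a \<Rightarrow> 'a list set" where
  "representatives G X g = {w \<in> lists (letters G X). word_value G w = g}"

definition word_norm :: "('a, 'b) monoid_scheme \<Rightarrow> 'a set \<Rightarrow> 'a \<Rightarrow> nat" where
  "word_norm G X g = (LEAST n. \<exists>w \<in> representatives G X g. length w = n)"

definition conj_closure :: "('a, 'b) monoid_scheme \<Rightarrow> 'a set \<Rightarrow> 'a set" where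
  "conj_closure G U = (\<Union>g \<in> carrier G. {inv\<^bsub>G\<^esub> g \<otimes>\<^bsub>G\<^esub> u \<otimes>\<^bsub>G\<^esub> g | u. u \<in> U})"

definition conj_norm :: "('a, 'b) monoid_scheme \<Rightarrow> 'a set \<Rightarrow> 'a \<Rightarrow> nat" where
  "conj_norm G X g = (LEAST n. \<exists>h \<in> conj_closure G {g}. word_norm G X h = n)"

text \<open>The order \<open>r\<close> on the letters is reflexive, whereas \<^const>\<open>lenlex\<close> (compare lengths first, then
  lexicographically from the left) expects a strict one; hence \<open>r - Id\<close>.\<close>

definition shortlex_rep ::
    "('a, 'b) monoid_scheme \<Rightarrow> 'a set \<Rightarrow> 'a rel \<Rightarrow> 'a \<Rightarrow> 'a list" where
  "shortlex_rep G X r g = (THE w. w \<in> representatives G X g \<and>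
     (\<forall>v \<in> representatives G X g. v = w \<or> (w, v) \<in> lenlex (r - Id)))"

definition ConjGeo :: "('a, 'b) monoid_scheme \<Rightarrow> 'a set \<Rightarrow> 'a set \<Rightarrow> 'a list set" where
  "ConjGeo G X U = {w \<in> lists (letters G X).
     length w = conj_norm G X (word_value G w) \<and> word_value G w \<in> conj_closure G U}"

definition ConjMinLenSL ::
    "('a, 'b) monoid_scheme \<Rightarrow> 'a set \<Rightarrow> 'a rel \<Rightarrow> 'a set \<Rightarrow> 'a list set" where
  "ConjMinLenSL G X r U =
     {shortlex_rep G X r g | g. g \<in> conj_closure G U \<and> word_norm G X g = conj_norm G X g}"


section \<open>The Cayley graph, hyperbolicity and quasiconvexity\<close>

text \<open>The arc \<open>(g, x)\<close> is the edge from \<open>g\<close> to \<open>g \<otimes> x\<close> labelled \<open>x\<close>. Inverses of generators are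
  letters as well, so every edge can be traversed in both directions by directed walks.\<close>

definition cayley_graph :: "('a, 'b) monoid_scheme \<Rightarrow> 'a set \<Rightarrow> ('a, 'a \<times> 'a) pre_digraph" where
  "cayley_graph G X = \<lparr> verts = carrier G, arcs = carrier G \<times> letters G X,
     tail = fst, head = (\<lambda>(g, x). g \<otimes>\<^bsub>G\<^esub> x) \<rparr>"

text \<open>Paths are combinatorial: a geodesic is an arc walk of least length between two vertices.
  Neighbourhoods are accordingly sets of vertices. Passing to the geometric realisation, with points
  inside edges, changes the constants in hyperbolicity and quasiconvexity, but not the notions.\<close>

definition graph_dist :: "('v, 'e) pre_digraph \<Rightarrow> 'v \<Rightarrow> 'v \<Rightarrow> nat" where
  "graph_dist \<Gamma> u v = (LEAST n. \<exists>p. pre_digraph.awalk \<Gamma> u p v \<and> length p = n)"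

definition geodesic :: "('v, 'e) pre_digraph \<Rightarrow> 'v \<Rightarrow> 'e list \<Rightarrow> 'v \<Rightarrow> bool" where
  "geodesic \<Gamma> u p v \<longleftrightarrow> pre_digraph.awalk \<Gamma> u p v \<and>
     (\<forall>q. pre_digraph.awalk \<Gamma> u q v \<longrightarrow> length p \<le> length q)"

definition walk_verts :: "('v, 'e) pre_digraph \<Rightarrow> 'v \<Rightarrow> 'e list \<Rightarrow> 'v set" where
  "walk_verts \<Gamma> u p = set (pre_digraph.awalk_verts \<Gamma> u p)"

definition nbhd :: "('v, 'e) pre_digraph \<Rightarrow> real \<Rightarrow> 'v set \<Rightarrow> 'v set" where
  "nbhd \<Gamma> \<delta> S = {v \<in> verts \<Gamma>. \<exists>s \<in> S. real (graph_dist \<Gamma> v s) \<le> \<delta>}"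

definition slim_triangles :: "('v, 'e) pre_digraph \<Rightarrow> real \<Rightarrow> bool" where
  "slim_triangles \<Gamma> \<delta> \<longleftrightarrow>
     (\<forall>a b c p q s. geodesic \<Gamma> a p b \<and> geodesic \<Gamma> b q c \<and> geodesic \<Gamma> c s a \<longrightarrow>
        walk_verts \<Gamma> a p \<subseteq> nbhd \<Gamma> \<delta> (walk_verts \<Gamma> b q \<union> walk_verts \<Gamma> c s) \<and>
        walk_verts \<Gamma> b q \<subseteq> nbhd \<Gamma> \<delta> (walk_verts \<Gamma> c s \<union> walk_verts \<Gamma> a p) \<and>
        walk_verts \<Gamma> c s \<subseteq> nbhd \<Gamma> \<delta> (walk_verts \<Gamma> a p \<union> walk_verts \<Gamma> b q))"

definition hyperbolic_group :: "('a, 'b) monoid_scheme \<Rightarrow> 'a set \<Rightarrow> bool" where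
  "hyperbolic_group G X \<longleftrightarrow> (\<exists>\<delta> \<ge> 0. slim_triangles (cayley_graph G X) \<delta>)"

definition quasiconvex :: "('a, 'b) monoid_scheme \<Rightarrow> 'a set \<Rightarrow> 'a set \<Rightarrow> bool" where
  "quasiconvex G X H \<longleftrightarrow> (\<exists>k \<ge> 0. \<forall>u \<in> H. \<forall>v \<in> H. \<forall>p.
     geodesic (cayley_graph G X) u p v \<longrightarrow>
       walk_verts (cayley_graph G X) u p \<subseteq> nbhd (cayley_graph G X) k H)"

end

theory Submission
  imports Defs
begin

text \<open>Let \<open>w\<close> be a long word all of whose cyclic permutations are geodesic. If \<open>w\<close> is conjugate into
  the quasiconvex subgroup \<open>H\<close>, or to a shorter element, then some cyclic permutation of \<open>w\<close> is already
  conjugated into \<open>H\<close>, respectively to a shorter element, by an element of bounded length. Hence,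
  up to finitely many words, ConjGeo consists of the words all of whose cyclic permutations are
  geodesic and not shortened by a short conjugator, and some cyclic permutation of which is conjugated
  into \<open>H\<close> by a short conjugator. Both conditions on geodesic words can be checked by a finite
  automaton because a geodesic prefix only matters through its relative distances to nearby points
  and through the nearby points of cosets of \<open>H\<close>, and regular languages are closed under cyclic
  permutation. ConjMinLenSL is the intersection of ConjGeo with the shortlex language, which is
  regular because geodesics with common end points fellow travel.\<close>

section \<open>Closure properties of regular languages\<close>

text \<open>Myhill-Nerode: equal values of \<open>f\<close> force equal left quotients of
  \<open>L\<close>, so there are finitely many quotients, and these become the states. Hence
  \<open>f\<close> may be any finite invariant, without transitions of its own.\<close>

lemma regular_languageI:
  assumes "finite A" "L \<subseteq> lists A" "finite (f ` lists A)"
    and f: "\<And>u v x. \<lbrakk>u \<in> lists A; v \<in> lists A; x \<in> lists A; f u = f v; u @ x \<in> L\<rbrakk> \<Longrightarrow> v @ x \<in> L"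
  shows "regular_language A L"
proof -
  define R where "R u = {x \<in> lists A. u @ x \<in> L}" for u
  have R: "R u = R v" if "u \<in> lists A" "v \<in> lists A" "f u = f v" for u v
    using f[of u v] f[of v u] that unfolding R_def by auto
  have "R u = R (inv_into (lists A) f (f u))" if "u \<in> lists A" for u
    by (rule R) (use that in \<open>simp_all only: inv_into_into f_inv_into_f imageI\<close>)
  then have "R ` lists A = (\<lambda>y. R (inv_into (lists A) f y)) ` f ` lists A"
    unfolding image_image by (rule image_cong[OF refl])
  then have "finite (R ` lists A)"
    using assms(3) by simp
  then obtain h :: "'a list set \<Rightarrow> nat" where h: "inj_on h (R ` lists A)"
    using finite_imp_inj_to_nat_seg by metis
  \<comment> \<open>States are quotients coded as numbers by \<open>h\<close>; reading
    \<open>a\<close> decodes the state and strips a leading \<open>a\<close> from its words.\<close>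
  define \<tau> where "\<tau> q a = h {x. a # x \<in> the_inv_into (R ` lists A) h q}" for q a
  have \<tau>: "\<tau> (h (R u)) a = h (R (u @ [a]))" if "u \<in> lists A" "a \<in> A" for u a
  proof -
    have "the_inv_into (R ` lists A) h (h (R u)) = R u"
      using h that by (simp add: the_inv_into_f_f)
    moreover have "{x. a # x \<in> R u} = R (u @ [a])"
      using that by (auto simp: R_def)
    ultimately show ?thesis
      by (simp add: \<tau>_def)
  qed
  have run: "foldl \<tau> (h (R [])) w = h (R w)" if "w \<in> lists A" for w
    using that by (induction w rule: rev_induct) (auto simp: \<tau>)
  define F where "F = h ` {q \<in> R ` lists A. [] \<in> q}"
  have "h (R w) \<in> F \<longleftrightarrow> w \<in> L" if "w \<in> lists A" for w
  proof -
    have "h (R w) \<in> F \<longleftrightarrow> [] \<in> R w"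
      unfolding F_def using that by (subst inj_on_image_mem_iff[OF h]) auto
    then show ?thesis
      by (simp add: R_def)
  qed
  then have "L = {w \<in> lists A. foldl \<tau> (h (R [])) w \<in> F}"
    using run \<open>L \<subseteq> lists A\<close> by (simp add: set_eq_iff subset_iff cong: conj_cong del: in_lists_conv_set) blast
  moreover have "finite (h ` R ` lists A)" "h (R []) \<in> h ` R ` lists A"
    "F \<subseteq> h ` R ` lists A"
    using \<open>finite (R ` lists A)\<close> by (auto simp: F_def)
  moreover have "\<forall>q \<in> h ` R ` lists A. \<forall>a \<in> A. \<tau> q a \<in> h ` R ` lists A"
  proof safe
    fix u a assume "a \<in> A" "\<forall>x\<in>set u. x \<in> A"
    then have "u \<in> lists A" "u @ [a] \<in> lists A"
      by auto
    then show "\<tau> (h (R u)) a \<in> h ` R ` lists A"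
      by (simp only: \<tau>[OF _ \<open>a \<in> A\<close>] imageI)
  qed
  ultimately show ?thesis
    using \<open>finite A\<close> unfolding regular_language_def by blast
qed

lemma foldl_closed:
  assumes "\<forall>q\<in>Q. \<forall>a\<in>A. \<tau> q a \<in> Q" "q \<in> Q" "w \<in> lists A"
  shows "foldl \<tau> q w \<in> Q"
  using assms(3,2) by (induction w arbitrary: q) (use assms(1) in auto)

text \<open>Stands for a morphism to a finite monoid that recognizes \<open>L\<close>, without
  naming the monoid: the kernel of \<open>T\<close> is a congruence of finite index and
  \<open>L\<close> is a union of classes. Compatibility on both sides allows factors to be
  reordered, as in cyclic permutations.\<close>

definition saturates :: "'a set \<Rightarrow> ('a list \<Rightarrow> 'q) \<Rightarrow> 'a list set \<Rightarrow> bool" where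
  "saturates A T L \<longleftrightarrow> finite A \<and> L \<subseteq> lists A \<and> finite (T ` lists A) \<and>
     (\<forall>u \<in> lists A. \<forall>v \<in> lists A. T u = T v \<longrightarrow> u \<in> L \<longrightarrow> v \<in> L) \<and>
     (\<forall>u \<in> lists A. \<forall>v \<in> lists A. \<forall>u' \<in> lists A. \<forall>v' \<in> lists A.
        T u = T u' \<longrightarrow> T v = T v' \<longrightarrow> T (u @ v) = T (u' @ v'))"

lemma saturatesD:
  assumes "saturates A T L"
  shows "finite A" "L \<subseteq> lists A" "finite (T ` lists A)"
    and "\<And>u v. \<lbrakk>T u = T v; u \<in> lists A; v \<in> lists A; u \<in> L\<rbrakk> \<Longrightarrow> v \<in> L"
    and "\<And>u v u' v'. \<lbrakk>T u = T u'; T v = T v'; u \<in> lists A; v \<in> lists A; u' \<in> lists A; v' \<in> lists A\<rbrakk>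
      \<Longrightarrow> T (u @ v) = T (u' @ v')"
  using assms unfolding saturates_def by blast+

lemma regular_languageE:
  assumes "regular_language A L"
  obtains T :: "'a list \<Rightarrow> nat \<Rightarrow> nat" where "saturates A T L"
proof -
  obtain Q :: "nat set" and q0 \<tau> F where *: "finite A" "finite Q" "q0 \<in> Q" "\<forall>q\<in>Q. \<forall>a\<in>A. \<tau> q a \<in> Q"
    "L = {w \<in> lists A. foldl \<tau> q0 w \<in> F}"
    using assms unfolding regular_language_def by blast
  \<comment> \<open>The action of words on the states is a congruence of finite index.\<close>
  define T where "T w = restrict (\<lambda>q. foldl \<tau> q w) Q" for w
  have T: "T w q = foldl \<tau> q w" if "q \<in> Q" for w q
    using that by (simp add: T_def)
  have "T ` lists A \<subseteq> Q \<rightarrow>\<^sub>E Q"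
    by (auto simp: T_def intro!: foldl_closed[OF *(4)])
  then have "finite (T ` lists A)"
    by (rule finite_subset) (simp add: *(2) finite_PiE)
  moreover have "T (u @ v) = T (u' @ v')"
    if "u' \<in> lists A" "T u = T u'" "T v = T v'" for u v u' v'
    unfolding T_def
  proof (rule restrict_ext)
    fix q assume "q \<in> Q"
    then have "foldl \<tau> q u = foldl \<tau> q u'" "foldl \<tau> q u' \<in> Q"
      using T[of q u] T[of q u'] that(2) foldl_closed[OF *(4) _ that(1), of q] by simp_all
    then show "foldl \<tau> q (u @ v) = foldl \<tau> q (u' @ v')"
      using T[of "foldl \<tau> q u'" v] T[of "foldl \<tau> q u'" v'] that(3) by simp
  qed
  moreover have "v \<in> L" if "v \<in> lists A" "T u = T v" "u \<in> L" for u v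
    using that T[OF *(3), of u] T[OF *(3), of v] unfolding *(5) by simp
  ultimately have "saturates A T L"
    using *(1,5) unfolding saturates_def by blast
  then show thesis
    by (rule that)
qed

lemma regular_language_compl:
  assumes "regular_language A L"
  shows "regular_language A (lists A - L)"
proof -
  obtain T :: "'a list \<Rightarrow> nat \<Rightarrow> nat" where T: "saturates A T L"
    using assms by (rule regular_languageE)
  show ?thesis
  proof (rule regular_languageI[of _ _ T])
    fix u v x assume *: "u \<in> lists A" "v \<in> lists A" "x \<in> lists A" "T u = T v" "u @ x \<in> lists A - L"
    then have "T (v @ x) = T (u @ x)"
      by (intro saturatesD(5)[OF T]) simp_all
    from saturatesD(4)[OF T this] * show "v @ x \<in> lists A - L"
      by auto
  qed (simp_all add: saturatesD(1,3)[OF T])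
qed

lemma regular_language_Int:
  assumes "regular_language A L" "regular_language A L'"
  shows "regular_language A (L \<inter> L')"
proof -
  obtain T :: "'a list \<Rightarrow> nat \<Rightarrow> nat" where T: "saturates A T L"
    using assms(1) by (rule regular_languageE)
  obtain T' :: "'a list \<Rightarrow> nat \<Rightarrow> nat" where T': "saturates A T' L'"
    using assms(2) by (rule regular_languageE)
  show ?thesis
  proof (rule regular_languageI[of _ _ "\<lambda>w. (T w, T' w)"])
    have "(\<lambda>w. (T w, T' w)) ` lists A \<subseteq> T ` lists A \<times> T' ` lists A"
      by auto
    then show "finite ((\<lambda>w. (T w, T' w)) ` lists A)"
      by (rule finite_subset) (intro finite_SigmaI saturatesD(3)[OF T] saturatesD(3)[OF T'])
    fix u v x
    assume *: "u \<in> lists A" "v \<in> lists A" "x \<in> lists A" "(T u, T' u) = (T v, T' v)" "u @ x \<in> L \<inter> L'"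
    have "T (u @ x) = T (v @ x)"
      by (intro saturatesD(5)[OF T]) (use * in simp_all)
    moreover have "T' (u @ x) = T' (v @ x)"
      by (intro saturatesD(5)[OF T']) (use * in simp_all)
    ultimately show "v @ x \<in> L \<inter> L'"
      using saturatesD(4)[OF T, of "u @ x" "v @ x"] saturatesD(4)[OF T', of "u @ x" "v @ x"] *
      by simp
  qed (use saturatesD(1,2)[OF T] in auto)
qed

lemma regular_language_eventually:
  assumes "regular_language A L"
    and eq: "\<And>w. \<lbrakk>w \<in> lists A; n \<le> length w\<rbrakk> \<Longrightarrow> w \<in> L' \<longleftrightarrow> w \<in> L"
    and "L' \<subseteq> lists A"
  shows "regular_language A L'"
proof -
  obtain T :: "'a list \<Rightarrow> nat \<Rightarrow> nat" where T: "saturates A T L"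
    using assms(1) by (rule regular_languageE)
  \<comment> \<open>A prefix of length at most \<open>n\<close> is remembered in full. A longer one
    puts all its extensions into the range where \<open>L\<close> and \<open>L'\<close> agree, so
    its class suffices.\<close>
  define f where "f w = (T w, if length w \<le> n then Some w else None)" for w
  show ?thesis
  proof (rule regular_languageI[of _ _ f])
    have "f ` lists A \<subseteq> T ` lists A \<times> insert None (Some ` {w. set w \<subseteq> A \<and> length w \<le> n})"
      by (force simp: f_def)
    moreover have "finite \<dots>"
      using saturatesD(1,3)[OF T] by (simp add: finite_lists_length_le)
    ultimately show "finite (f ` lists A)"
      by (rule finite_subset)
    fix u v x assume *: "u \<in> lists A" "v \<in> lists A" "x \<in> lists A" "f u = f v" "u @ x \<in> L'"
    show "v @ x \<in> L'"
    proof (cases "length u \<le> n")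
      case True
      with * show ?thesis by (auto simp: f_def split: if_splits)
    next
      case False
      with *(4) have "n < length u" "n < length v" "T u = T v"
        by (auto simp: f_def split: if_splits)
      then have "T (u @ x) = T (v @ x)"
        using * by (intro saturatesD(5)[OF T]) simp_all
      moreover have "u @ x \<in> L"
        using * \<open>n < length u\<close> eq[of "u @ x"] by simp
      ultimately have "v @ x \<in> L"
        using * saturatesD(4)[OF T, of "u @ x" "v @ x"] by simp
      then show ?thesis
        using * \<open>n < length v\<close> eq[of "v @ x"] by simp
    qed
  qed (use saturatesD(1-3)[OF T] assms(3) in auto)
qed

definition cyclic_closure :: "'a list set \<Rightarrow> 'a list set" where
  "cyclic_closure L = {v @ u |u v. u @ v \<in> L}"

lemma regular_language_cyclic_closure:
  assumes "regular_language A L"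
  shows "regular_language A (cyclic_closure L)"
proof -
  obtain T :: "'a list \<Rightarrow> nat \<Rightarrow> nat" where T: "saturates A T L"
    using assms by (rule regular_languageE)
  \<comment> \<open>The set of pairs serves the case that the cut of a cyclic permutation falls
    inside the prefix \<open>w\<close>; if the cut falls into the extension, \<open>T w\<close> is
    enough.\<close>
  define f where "f w = (T w, {(T u, T v) |u v. w = u @ v})" for w
  show ?thesis
  proof (rule regular_languageI[of _ _ f])
    have "f ` lists A \<subseteq> T ` lists A \<times> Pow (T ` lists A \<times> T ` lists A)"
      by (auto simp: f_def)
    then show "finite (f ` lists A)"
      by (rule finite_subset) (simp add: saturatesD(3)[OF T])
    show "cyclic_closure L \<subseteq> lists A"
      using saturatesD(2)[OF T] by (force simp: cyclic_closure_def)
    fix w w' x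
    assume *: "w \<in> lists A" "w' \<in> lists A" "x \<in> lists A" "f w = f w'" "w @ x \<in> cyclic_closure L"
    then obtain u v where uv: "u @ v \<in> L" "w @ x = v @ u"
      by (auto simp: cyclic_closure_def)
    have uvA: "u \<in> lists A" "v \<in> lists A"
      using uv(1) saturatesD(2)[OF T] by auto
    from uv(2) consider y where "w = v @ y" "y @ x = u" | y where "w @ y = v" "x = y @ u"
      by (auto simp: append_eq_append_conv2)
    then show "w' @ x \<in> cyclic_closure L"
    proof cases
      case 1
      then have "(T v, T y) \<in> snd (f w)"
        unfolding f_def snd_conv by blast
      then have "(T v, T y) \<in> snd (f w')"
        by (simp only: *(4))
      then obtain v' y' where w': "w' = v' @ y'" "T v' = T v" "T y' = T y"
        unfolding f_def by auto
      have in_lists: "y \<in> lists A" "v' \<in> lists A" "y' \<in> lists A"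
        using * uvA 1 w'(1) by auto
      have "T (x @ v) = T (x @ v')"
        using saturatesD(5)[OF T, of x x v v'] w'(2) * uvA in_lists by simp
      then have "T (y @ (x @ v)) = T (y' @ (x @ v'))"
        using saturatesD(5)[OF T, of y y' "x @ v" "x @ v'"] w'(3) * uvA in_lists by simp
      then have "y' @ x @ v' \<in> L"
        using saturatesD(4)[OF T, of "y @ x @ v" "y' @ x @ v'"] uv(1) 1(2) * uvA in_lists by auto
      then show ?thesis
        using w'(1) unfolding cyclic_closure_def
        by (intro CollectI exI[of _ "y' @ x"] exI[of _ v']) simp
    next
      case 2
      have "T w = T w'"
        using *(4) by (simp add: f_def)
      moreover have y: "y \<in> lists A"
        using 2(1) uvA by auto
      ultimately have "T (w @ y) = T (w' @ y)"
        using saturatesD(5)[OF T, of w w' y y] * by simp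
      then have "T (u @ (w @ y)) = T (u @ (w' @ y))"
        using saturatesD(5)[OF T, of u u "w @ y" "w' @ y"] * uvA y by simp
      then have "u @ w' @ y \<in> L"
        using saturatesD(4)[OF T, of "u @ w @ y" "u @ w' @ y"] uv(1) 2(1) * uvA y by auto
      then show ?thesis
        using 2(2) unfolding cyclic_closure_def
        by (intro CollectI exI[of _ u] exI[of _ "w' @ y"]) simp
    qed
  qed (use saturatesD(1-3)[OF T] in auto)
qed

section \<open>The word metric\<close>

locale fg_group = group G for G (structure) +
  fixes X :: "'a set"
  assumes fin_X: "finite X" and X_closed: "X \<subseteq> carrier G" and gen_X: "generate G X = carrier G"
begin

declare in_lists_conv_set [simp del]

lemma cancel_left [simp]:
  assumes "a \<in> carrier G" "b \<in> carrier G"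
  shows "inv a \<otimes> (a \<otimes> b) = b" "a \<otimes> (inv a \<otimes> b) = b"
  using assms by (simp_all add: m_assoc[symmetric])

abbreviation A where "A \<equiv> letters G X"
abbreviation val where "val \<equiv> word_value G"
abbreviation N where "N \<equiv> word_norm G X"

lemma finite_letters: "finite A"
  using fin_X by (simp add: letters_def)

lemma letter_closed [simp]: "x \<in> A \<Longrightarrow> x \<in> carrier G"
  using X_closed by (auto simp: letters_def)

lemma inv_letter: "x \<in> A \<Longrightarrow> inv x \<in> A"
  using X_closed by (auto simp: letters_def)

lemma val_Nil [simp]: "val [] = \<one>"
  by (simp add: word_value_def)

lemma val_Cons [simp]: "val (x # w) = x \<otimes> val w"
  by (simp add: word_value_def)

lemma val_closed [simp]: "w \<in> lists A \<Longrightarrow> val w \<in> carrier G"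
  by (induction w) auto

lemma val_append [simp]: "u \<in> lists A \<Longrightarrow> v \<in> lists A \<Longrightarrow> val (u @ v) = val u \<otimes> val v"
  by (induction u) (auto simp: m_assoc)

lemma inv_word: "w \<in> lists A \<Longrightarrow> rev (map (m_inv G) w) \<in> lists A"
  using inv_letter by (induction w) auto

lemma val_inv: "w \<in> lists A \<Longrightarrow> val (rev (map (m_inv G) w)) = inv (val w)"
  by (induction w) (auto simp: inv_mult_group inv_letter inv_word)

lemma ex_word: "g \<in> carrier G \<Longrightarrow> \<exists>w \<in> lists A. val w = g"
  unfolding gen_X[symmetric]
proof (induction rule: generate.induct)
  case one
  show ?case by (rule bexI[of _ "[]"]) auto
next
  case (incl h)
  then show ?case using X_closed by (intro bexI[of _ "[h]"]) (auto simp: letters_def)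
next
  case (inv h)
  then show ?case using X_closed by (intro bexI[of _ "[inv h]"]) (auto simp: letters_def)
next
  case (eng g h)
  then obtain u v where "u \<in> lists A" "val u = g" "v \<in> lists A" "val v = h" by blast
  then show ?case
    by (intro bexI[of _ "u @ v"]) simp_all
qed

lemma ex_geodesic_word:
  assumes "g \<in> carrier G"
  obtains w where "w \<in> lists A" "val w = g" "length w = N g"
proof -
  obtain v where "v \<in> representatives G X g"
    using ex_word[OF assms] by (auto simp: representatives_def)
  then have "\<exists>w \<in> representatives G X g. length w = N g"
    unfolding word_norm_def by (intro LeastI[of "\<lambda>n. \<exists>w \<in> representatives G X g. length w = n"]) auto
  then show thesis
    using that by (auto simp: representatives_def)
qed

lemma N_val_le: "w \<in> lists A \<Longrightarrow> N (val w) \<le> length w"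
  unfolding word_norm_def by (rule Least_le) (auto simp: representatives_def)

lemma N_one [simp]: "N \<one> = 0"
  using N_val_le[of "[]"] by simp

lemma N_mult:
  assumes "g \<in> carrier G" "h \<in> carrier G"
  shows "N (g \<otimes> h) \<le> N g + N h"
proof -
  obtain u where "u \<in> lists A" "val u = g" "length u = N g"
    using assms(1) by (rule ex_geodesic_word)
  moreover obtain v where "v \<in> lists A" "val v = h" "length v = N h"
    using assms(2) by (rule ex_geodesic_word)
  ultimately show ?thesis
    using N_val_le[of "u @ v"] by simp
qed

lemma N_inv [simp]:
  assumes "g \<in> carrier G"
  shows "N (inv g) = N g"
proof -
  have le: "N (inv g) \<le> N g" if "g \<in> carrier G" for g
  proof -
    obtain u where u: "u \<in> lists A" "val u = g" "length u = N g"
      using \<open>g \<in> carrier G\<close> by (rule ex_geodesic_word)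
    then show ?thesis
      using N_val_le[OF inv_word, of u] by (auto simp: val_inv)
  qed
  show ?thesis
    using le[OF assms] le[of "inv g"] assms by simp
qed

lemma N_letter: "x \<in> A \<Longrightarrow> N x \<le> 1"
  using N_val_le[of "[x]"] by simp

definition B :: "nat \<Rightarrow> 'a set" where
  "B n = {g \<in> carrier G. N g \<le> n}"

lemma B_closed: "g \<in> B n \<Longrightarrow> g \<in> carrier G"
  by (simp add: B_def)

lemma finite_B: "finite (B n)"
proof (rule finite_subset)
  show "B n \<subseteq> val ` {w. set w \<subseteq> A \<and> length w \<le> n}"
  proof
    fix g assume "g \<in> B n"
    then have g: "g \<in> carrier G" "N g \<le> n"
      by (auto simp: B_def)
    obtain w where "w \<in> lists A" "val w = g" "length w = N g"
      using g(1) by (rule ex_geodesic_word)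
    with g(2) show "g \<in> val ` {w. set w \<subseteq> A \<and> length w \<le> n}"
      by (intro image_eqI[of _ _ w]) (simp_all add: in_lists_conv_set subset_iff)
  qed
  show "finite (val ` {w. set w \<subseteq> A \<and> length w \<le> n})"
    by (intro finite_imageI finite_lists_length_le finite_letters)
qed

definition d :: "'a \<Rightarrow> 'a \<Rightarrow> nat" where
  "d a b = N (inv a \<otimes> b)"

lemma d_self [simp]: "a \<in> carrier G \<Longrightarrow> d a a = 0"
  by (simp add: d_def)

lemma d_sym: "a \<in> carrier G \<Longrightarrow> b \<in> carrier G \<Longrightarrow> d a b = d b a"
  using N_inv[of "inv a \<otimes> b"] by (simp add: d_def inv_mult_group)

lemma d_triangle:
  assumes "a \<in> carrier G" "b \<in> carrier G" "c \<in> carrier G"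
  shows "d a c \<le> d a b + d b c"
  using N_mult[of "inv a \<otimes> b" "inv b \<otimes> c"] assms by (simp add: d_def m_assoc)

lemma d_left: "\<lbrakk>g \<in> carrier G; a \<in> carrier G; b \<in> carrier G\<rbrakk> \<Longrightarrow> d (g \<otimes> a) (g \<otimes> b) = d a b"
  by (simp add: d_def inv_mult_group m_assoc)

lemma d_mult_right: "\<lbrakk>a \<in> carrier G; b \<in> carrier G\<rbrakk> \<Longrightarrow> d a (a \<otimes> b) = N b"
  by (simp add: d_def)

lemma d_one: "b \<in> carrier G \<Longrightarrow> d \<one> b = N b"
  by (simp add: d_def)

text \<open>The vertices on geodesics from \<open>a\<close> to \<open>b\<close>, described by
  distances alone. Geodesic walks serve only to translate hyperbolicity and quasiconvexity into
  statements about intervals.\<close>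

definition interval :: "'a \<Rightarrow> 'a \<Rightarrow> 'a set" where
  "interval a b = {m \<in> carrier G. d a m + d m b = d a b}"

lemma interval_closed: "m \<in> interval a b \<Longrightarrow> m \<in> carrier G"
  by (simp add: interval_def)

lemma interval_sym: "a \<in> carrier G \<Longrightarrow> b \<in> carrier G \<Longrightarrow> interval a b = interval b a"
  by (auto simp: interval_def d_sym add.commute)

section \<open>Geodesics in the Cayley graph\<close>

abbreviation Cay where "Cay \<equiv> cayley_graph G X"

lemma Cay_simps [simp]:
  "verts Cay = carrier G" "arcs Cay = carrier G \<times> A" "tail Cay e = fst e"
  "head Cay e = fst e \<otimes> snd e"
  by (simp_all add: cayley_graph_def split_beta)

sublocale Cay: wf_digraph Cay
  by unfold_locales auto

declare Cay.awalkE' [rule del]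

lemma awalk_closed:
  assumes "Cay.awalk a p b"
  shows "a \<in> carrier G" "b \<in> carrier G"
  using Cay.awalk_hd_in_verts[OF assms] Cay.awalk_last_in_verts[OF assms] by simp_all

lemma d_le_length:
  "Cay.awalk a p b \<Longrightarrow> d a b \<le> length p"
proof (induction p arbitrary: a)
  case Nil
  then show ?case by (auto simp: Cay.awalk_Nil_iff)
next
  case (Cons e p)
  then have e: "e \<in> carrier G \<times> A" "a = fst e" and p: "Cay.awalk (fst e \<otimes> snd e) p b"
    by (auto simp: Cay.awalk_Cons_iff)
  have b: "b \<in> carrier G"
    by (rule awalk_closed(2)[OF p])
  have "d a b \<le> d a (a \<otimes> snd e) + d (a \<otimes> snd e) b"
    using e b by (intro d_triangle) auto
  also have "d a (a \<otimes> snd e) \<le> 1"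
    using e N_letter[of "snd e"] by (auto simp: d_mult_right)
  finally show ?case
    using Cons.IH[OF p] e by simp
qed

lemma awalk_of_word:
  "w \<in> lists A \<Longrightarrow> a \<in> carrier G \<Longrightarrow> \<exists>p. Cay.awalk a p (a \<otimes> val w) \<and> length p = length w"
proof (induction w arbitrary: a)
  case Nil
  then show ?case by (auto simp: Cay.awalk_Nil_iff)
next
  case (Cons x w)
  then have x: "x \<in> A" "w \<in> lists A" "a \<otimes> x \<in> carrier G"
    by simp_all
  obtain p where "Cay.awalk (a \<otimes> x) p (a \<otimes> x \<otimes> val w)" "length p = length w"
    using Cons.IH[OF x(2,3)] by blast
  with x \<open>a \<in> carrier G\<close> show ?case
    by (intro exI[of _ "(a, x) # p"]) (simp add: Cay.awalk_Cons_iff m_assoc)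
qed

lemma ex_awalk:
  assumes "a \<in> carrier G" "b \<in> carrier G"
  shows "\<exists>p. Cay.awalk a p b \<and> length p = d a b"
proof -
  have "inv a \<otimes> b \<in> carrier G"
    using assms by simp
  then obtain w where "w \<in> lists A" "val w = inv a \<otimes> b" "length w = N (inv a \<otimes> b)"
    by (rule ex_geodesic_word)
  then show ?thesis
    using awalk_of_word[of w a] assms by (auto simp: d_def)
qed

lemma geodesic_iff:
  "geodesic Cay a p b \<longleftrightarrow> Cay.awalk a p b \<and> length p = d a b"
proof
  assume p: "geodesic Cay a p b"
  then have "a \<in> carrier G" "b \<in> carrier G"
    by (auto simp: geodesic_def dest: awalk_closed)
  then obtain q where "Cay.awalk a q b" "length q = d a b"
    using ex_awalk by blast
  with p have "Cay.awalk a p b" "length p \<le> d a b"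
    unfolding geodesic_def by auto
  then show "Cay.awalk a p b \<and> length p = d a b"
    using d_le_length[of a p b] by simp
qed (auto simp: geodesic_def d_le_length)

lemma graph_dist_eq:
  assumes "a \<in> carrier G" "b \<in> carrier G"
  shows "graph_dist Cay a b = d a b"
  unfolding graph_dist_def
  using ex_awalk[OF assms] d_le_length[of a _ b] by (intro Least_equality) blast+

text \<open>The walk splits at \<open>m\<close> into two walks whose lengths bound the two distances
  from above and add up to \<open>d a b\<close>; the triangle inequality forces equality.\<close>

lemma walk_verts_interval:
  assumes "geodesic Cay a p b"
  shows "walk_verts Cay a p \<subseteq> interval a b"
proof
  fix m assume "m \<in> walk_verts Cay a p"
  then obtain q s where *: "p = q @ s" "Cay.awalk a q m" "Cay.awalk m s b"
    using Cay.awalk_decomp[of a p b m] assms by (auto simp: geodesic_iff walk_verts_def)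
  have "a \<in> carrier G" "b \<in> carrier G" "m \<in> carrier G"
    using *(2,3) by (auto dest: awalk_closed)
  moreover have "length q + length s = d a b"
    using assms *(1) by (simp only: geodesic_iff length_append)
  ultimately show "m \<in> interval a b"
    using d_le_length[OF *(2)] d_le_length[OF *(3)] d_triangle[of a m b]
    by (simp add: interval_def)
qed

lemma ex_geodesic_through:
  assumes "a \<in> carrier G" "b \<in> carrier G" "m \<in> interval a b"
  obtains p where "geodesic Cay a p b" "m \<in> walk_verts Cay a p"
proof -
  have "m \<in> carrier G"
    using assms(3) by (rule interval_closed)
  then obtain q s where *: "Cay.awalk a q m" "length q = d a m" "Cay.awalk m s b" "length s = d m b"
    using ex_awalk[of a m] ex_awalk[of m b] assms(1,2) by blast
  then have "Cay.awalk a (q @ s) b"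
    by (intro Cay.awalk_appendI)
  moreover from this have "m \<in> set (Cay.awalk_verts a (q @ s))"
    using Cay.awalk_verts_append2[of a q s b] Cay.awlast_of_awalk[OF *(1)]
      Cay.hd_in_awalk_verts(1)[OF *(3)] by simp
  ultimately show thesis
    using that[of "q @ s"] * assms(3) by (auto simp: geodesic_iff interval_def walk_verts_def)
qed

end

section \<open>Hyperbolicity and quasiconvexity in terms of intervals\<close>

locale hyp_group = fg_group +
  fixes D :: nat
  assumes slim: "\<lbrakk>a \<in> carrier G; b \<in> carrier G; c \<in> carrier G; m \<in> interval a b\<rbrakk>
    \<Longrightarrow> \<exists>n \<in> interval b c \<union> interval c a. d m n \<le> D"

text \<open>A point of an interval lies on some geodesic, which is completed to a triangle by
  arbitrary geodesics. Rounding the bound up makes it a natural number.\<close>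

lemma (in fg_group) hyp_groupI:
  assumes "hyperbolic_group G X"
  obtains D where "hyp_group G X D"
proof -
  obtain \<delta> where \<delta>: "0 \<le> \<delta>" "slim_triangles Cay \<delta>"
    using assms unfolding hyperbolic_group_def by blast
  have "hyp_group G X (nat \<lceil>\<delta>\<rceil>)"
  proof unfold_locales
    fix a b c m
    assume *: "a \<in> carrier G" "b \<in> carrier G" "c \<in> carrier G" "m \<in> interval a b"
    obtain p where p: "geodesic Cay a p b" "m \<in> walk_verts Cay a p"
      using *(1,2,4) by (rule ex_geodesic_through)
    obtain q where q: "geodesic Cay b q c"
      using ex_awalk[OF *(2,3)] by (auto simp: geodesic_iff)
    obtain s where s: "geodesic Cay c s a"
      using ex_awalk[OF *(3,1)] by (auto simp: geodesic_iff)
    have "m \<in> nbhd Cay \<delta> (walk_verts Cay b q \<union> walk_verts Cay c s)"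
      using \<delta>(2) p q s unfolding slim_triangles_def by blast
    then obtain n where n: "n \<in> walk_verts Cay b q \<union> walk_verts Cay c s" "real (graph_dist Cay m n) \<le> \<delta>"
      by (auto simp: nbhd_def)
    then have "n \<in> interval b c \<union> interval c a"
      using walk_verts_interval[OF q] walk_verts_interval[OF s] by blast
    moreover from this have "graph_dist Cay m n = d m n"
      using *(4) by (intro graph_dist_eq) (auto dest: interval_closed)
    ultimately show "\<exists>n \<in> interval b c \<union> interval c a. d m n \<le> nat \<lceil>\<delta>\<rceil>"
      using n(2) by (intro bexI[of _ n]) linarith+
  qed
  then show thesis
    by (rule that)
qed

lemma (in fg_group) quasiconvex_interval:
  assumes "quasiconvex G X H" "H \<subseteq> carrier G"
  obtains k where "\<And>u v m. \<lbrakk>u \<in> H; v \<in> H; m \<in> interval u v\<rbrakk> \<Longrightarrow> \<exists>h \<in> H. d m h \<le> k"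
proof -
  obtain k where k: "\<forall>u \<in> H. \<forall>v \<in> H. \<forall>p. geodesic Cay u p v \<longrightarrow> walk_verts Cay u p \<subseteq> nbhd Cay k H"
    using assms unfolding quasiconvex_def by blast
  have "\<exists>h \<in> H. d m h \<le> nat \<lceil>k\<rceil>" if uvm: "u \<in> H" "v \<in> H" "m \<in> interval u v" for u v m
  proof -
    have "u \<in> carrier G" "v \<in> carrier G"
      using uvm(1,2) assms(2) by auto
    then obtain p where p: "geodesic Cay u p v" "m \<in> walk_verts Cay u p"
      using uvm(3) by (rule ex_geodesic_through)
    then obtain h where h: "h \<in> H" "real (graph_dist Cay m h) \<le> k"
      using k uvm(1,2) by (force simp: nbhd_def)
    moreover from h(1) have "graph_dist Cay m h = d m h"
      using assms(2) interval_closed[OF uvm(3)] by (intro graph_dist_eq) auto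
    ultimately show ?thesis
      by (intro bexI[of _ h]) linarith+
  qed
  then show thesis
    by (rule that)
qed

lemma lex_append_cases:
  assumes "length t = length u" "(t @ y, u @ x) \<in> lex R"
  shows "(t, u) \<in> lex R \<or> t = u \<and> (y, x) \<in> lex R"
  using assms by (induction t u rule: list_induct2) auto

section \<open>Conjugation and geodesic words\<close>

context fg_group
begin

lemma interval_left:
  assumes "g \<in> carrier G" "a \<in> carrier G" "b \<in> carrier G"
    and n: "n \<in> interval (g \<otimes> a) (g \<otimes> b)"
  shows "inv g \<otimes> n \<in> interval a b"
proof -
  have nc: "n \<in> carrier G"
    using n by (rule interval_closed)
  have "d a (inv g \<otimes> n) = d (g \<otimes> a) n" "d (inv g \<otimes> n) b = d n (g \<otimes> b)"
    using d_left[of g a "inv g \<otimes> n"] d_left[of g "inv g \<otimes> n" b] assms(1-3) nc by simp_all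
  then show ?thesis
    using n nc assms(1-3) by (simp add: interval_def d_left)
qed

lemma interval_le:
  assumes "n \<in> interval a b"
  shows "d a n \<le> d a b" "d n b \<le> d a b"
  using assms by (auto simp: interval_def)

definition conjugate :: "'a \<Rightarrow> 'a \<Rightarrow> 'a" where
  "conjugate g a = inv g \<otimes> a \<otimes> g"

lemma conjugate_closed [simp]: "g \<in> carrier G \<Longrightarrow> a \<in> carrier G \<Longrightarrow> conjugate g a \<in> carrier G"
  by (simp add: conjugate_def)

lemma conjugate_mult:
  "\<lbrakk>g \<in> carrier G; h \<in> carrier G; a \<in> carrier G\<rbrakk> \<Longrightarrow> conjugate (g \<otimes> h) a = conjugate h (conjugate g a)"
  by (simp add: conjugate_def m_assoc inv_mult_group)

lemma conjugate_one [simp]: "a \<in> carrier G \<Longrightarrow> conjugate \<one> a = a"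
  by (simp add: conjugate_def)

lemma conjugate_inv [simp]:
  assumes "g \<in> carrier G" "a \<in> carrier G"
  shows "conjugate (inv g) (conjugate g a) = a" "conjugate g (conjugate (inv g) a) = a"
  using assms by (simp_all flip: conjugate_mult)

lemma conj_closure_iff:
  assumes "a \<in> carrier G" "U \<subseteq> carrier G"
  shows "a \<in> conj_closure G U \<longleftrightarrow> (\<exists>g \<in> carrier G. conjugate g a \<in> U)"
proof
  assume "a \<in> conj_closure G U"
  then obtain g u where "g \<in> carrier G" "u \<in> U" "a = conjugate g u"
    by (auto simp: conj_closure_def conjugate_def)
  then show "\<exists>g \<in> carrier G. conjugate g a \<in> U"
    using assms(2) by (intro bexI[of _ "inv g"]) auto
next
  assume "\<exists>g \<in> carrier G. conjugate g a \<in> U"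
  then obtain g where "g \<in> carrier G" "conjugate g a \<in> U"
    by blast
  moreover from this have "a = conjugate (inv g) (conjugate g a)"
    using assms(1) by simp
  ultimately show "a \<in> conj_closure G U"
    unfolding conj_closure_def conjugate_def by (intro UN_I[of "inv g"]) auto
qed

lemma conj_norm_le:
  assumes "g \<in> carrier G"
  shows "conj_norm G X a \<le> N (conjugate g a)"
  unfolding conj_norm_def using assms
  by (intro Least_le bexI[of _ "conjugate g a"]) (auto simp: conj_closure_def conjugate_def)

lemma conj_norm_attained:
  assumes "a \<in> carrier G"
  obtains g where "g \<in> carrier G" "N (conjugate g a) = conj_norm G X a"
proof -
  have "\<exists>h \<in> conj_closure G {a}. N h = conj_norm G X a"
    unfolding conj_norm_def
    by (rule LeastI[of _ "N a"]) (use assms in \<open>auto simp: conj_closure_def intro!: exI[of _ a] bexI[of _ "\<one>"]\<close>)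
  then show thesis
    using that by (auto simp: conj_closure_def conjugate_def)
qed

lemma conj_norm_conjugate:
  assumes "a \<in> carrier G" "g \<in> carrier G"
  shows "conj_norm G X (conjugate g a) = conj_norm G X a"
proof -
  have le: "conj_norm G X (conjugate g a) \<le> conj_norm G X a" if "a \<in> carrier G" "g \<in> carrier G" for a g
  proof -
    obtain h where h: "h \<in> carrier G" "N (conjugate h a) = conj_norm G X a"
      using \<open>a \<in> carrier G\<close> by (rule conj_norm_attained)
    have "conjugate (inv g \<otimes> h) (conjugate g a) = conjugate h a"
      using that h(1) by (simp add: conjugate_mult)
    then show ?thesis
      using conj_norm_le[of "inv g \<otimes> h" "conjugate g a"] that h by simp
  qed
  show ?thesis
    using le[OF assms] le[of "conjugate g a" "inv g"] assms by simp
qed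

lemma val_rotate:
  "u \<in> lists A \<Longrightarrow> v \<in> lists A \<Longrightarrow> val (v @ u) = conjugate (val u) (val (u @ v))"
  by (simp add: conjugate_def m_assoc)

definition geo :: "'a list \<Rightarrow> bool" where
  "geo w \<longleftrightarrow> w \<in> lists A \<and> N (val w) = length w"

lemma geo_lists: "geo w \<Longrightarrow> w \<in> lists A"
  by (simp add: geo_def)

lemma geo_length: "geo w \<Longrightarrow> N (val w) = length w"
  by (simp add: geo_def)

lemma geo_appendD:
  assumes "geo (u @ v)"
  shows "geo u" "geo v"
proof -
  have uv: "u \<in> lists A" "v \<in> lists A"
    using assms by (auto simp: geo_def)
  then have "N (val u \<otimes> val v) = length u + length v"
    using assms by (simp add: geo_def)
  with uv have "N (val u) = length u \<and> N (val v) = length v"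
    using N_mult[of "val u" "val v"] N_val_le[of u] N_val_le[of v] by simp
  then show "geo u" "geo v"
    using uv by (simp_all add: geo_def)
qed

lemma geo_interval:
  assumes "geo (u @ v)"
  shows "val u \<in> interval \<one> (val (u @ v))"
proof -
  have "u \<in> lists A" "v \<in> lists A"
    using geo_appendD[OF assms] by (simp_all add: geo_lists)
  then show ?thesis
    using geo_appendD[OF assms] assms by (simp add: interval_def geo_def d_one d_mult_right)
qed

text \<open>A shortlex-smaller word for the value of a geodesic word cannot be shorter, so for
  \<open>R = r - Id\<close> comparing words of equal length detects exactly the geodesic words that
  are not shortlex representatives.\<close>

definition lex_reducible :: "'a rel \<Rightarrow> 'a list set" where
  "lex_reducible R =
    {w. geo w \<and> (\<exists>s \<in> lists A. length s = length w \<and> val s = val w \<and> (s, w) \<in> lex R)}"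

end

section \<open>Slim quadrilaterals and bigons\<close>

context hyp_group
begin

text \<open>The diagonal from \<open>a\<close> to \<open>c\<close> cuts the quadrilateral into two
  triangles, each contributing \<open>D\<close>.\<close>

lemma quadrilateral:
  assumes "a \<in> carrier G" "b \<in> carrier G" "c \<in> carrier G" "e \<in> carrier G" "m \<in> interval a b"
  obtains n where "n \<in> interval b c \<union> interval c e \<union> interval e a" "d m n \<le> 2 * D"
proof -
  have mc: "m \<in> carrier G"
    using assms(5) by (rule interval_closed)
  obtain n where n: "n \<in> interval b c \<union> interval c a" "d m n \<le> D"
    using slim[OF assms(1-3,5)] by blast
  show thesis
  proof (cases "n \<in> interval b c")
    case True
    with n(2) show thesis by (intro that[of n]) auto
  next
    case False
    then have n': "n \<in> interval c a"
      using n by blast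
    obtain p where p: "p \<in> interval a e \<union> interval e c" "d n p \<le> D"
      using slim[OF assms(3,1,4) n'] by blast
    then have "p \<in> interval c e \<union> interval e a" "p \<in> carrier G"
      using interval_sym assms by (auto dest: interval_closed)
    moreover have "d m p \<le> d m n + d n p"
      using mc n' \<open>p \<in> carrier G\<close> by (intro d_triangle) (auto dest: interval_closed)
    ultimately show thesis
      using that[of p] n(2) p(2) by auto
  qed
qed

text \<open>If the nearby point lies on a short side, it is replaced by the end point
  \<open>c\<close> or \<open>e\<close> of that side, at a further cost of at most
  \<open>R\<close>.\<close>

lemma quadrilateral_near:
  assumes "a \<in> carrier G" "b \<in> carrier G" "c \<in> carrier G" "e \<in> carrier G" "m \<in> interval a b"
    and "d b c \<le> R" "d e a \<le> R"
  obtains n where "n \<in> interval c e" "d m n \<le> 2 * D + R"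
proof -
  have mc: "m \<in> carrier G"
    using assms(5) by (rule interval_closed)
  obtain n where n: "n \<in> interval b c \<union> interval c e \<union> interval e a" "d m n \<le> 2 * D"
    using assms(1-5) by (rule quadrilateral)
  have nc: "n \<in> carrier G"
    using n(1) by (auto dest: interval_closed)
  consider "n \<in> interval b c" | "n \<in> interval c e" | "n \<in> interval e a"
    using n(1) by blast
  then show thesis
  proof cases
    case 1
    then have "d m c \<le> 2 * D + R"
      using d_triangle[OF mc nc assms(3)] interval_le(2)[OF 1] n(2) assms(6) by simp
    then show thesis
      using assms by (intro that[of c]) (auto simp: interval_def)
  next
    case 2
    then show thesis using that n(2) by simp
  next
    case 3
    then have "d m e \<le> 2 * D + R"
      using d_triangle[OF mc nc assms(4)] interval_le(1)[OF 3] n(2) assms(7) d_sym[of n e] assms(4) nc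
      by simp
    then show thesis
      using assms by (intro that[of e]) (auto simp: interval_def)
  qed
qed

text \<open>The triangle \<open>a\<close>, \<open>b\<close>, \<open>m'\<close> is degenerate. The
  point within \<open>D\<close> of \<open>m\<close> lies on a geodesic from \<open>m'\<close> to one
  of the ends; as \<open>m\<close> and \<open>m'\<close> are equally far from that end, this point
  is within \<open>D\<close> of \<open>m'\<close> too.\<close>

lemma bigon:
  assumes "a \<in> carrier G" "b \<in> carrier G" "m \<in> interval a b" "m' \<in> interval a b" "d a m = d a m'"
  shows "d m m' \<le> 2 * D"
proof -
  have c: "m \<in> carrier G" "m' \<in> carrier G"
    using assms(3,4) by (auto dest: interval_closed)
  have dm: "d a m + d m b = d a b" "d a m' + d m' b = d a b"
    using assms(3,4) by (auto simp: interval_def)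
  obtain n where n: "n \<in> interval b m' \<union> interval m' a" "d m n \<le> D"
    using slim[OF assms(1,2) c(2) assms(3)] by blast
  have nc: "n \<in> carrier G"
    using n(1) by (auto dest: interval_closed)
  note syms = d_sym[OF nc c(2)] d_sym[OF nc assms(1)] d_sym[OF nc assms(2)] d_sym[OF c(2) assms(1)]
    d_sym[OF c(2) assms(2)]
  have "d n m' \<le> D"
  proof (cases "n \<in> interval b m'")
    case True
    then have "d b n + d n m' = d b m'"
      by (simp add: interval_def)
    moreover have "d m b \<le> d m n + d n b"
      using c nc assms by (intro d_triangle)
    ultimately show ?thesis
      using dm assms(5) n(2) syms by simp
  next
    case False
    then have "d m' n + d n a = d m' a"
      using n(1) by (auto simp: interval_def)
    moreover have "d a m \<le> d a n + d n m"
      using c nc assms by (intro d_triangle)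
    ultimately show ?thesis
      using assms(5) n(2) syms d_sym[OF nc c(1)] by simp
  qed
  then show ?thesis
    using d_triangle[OF c(1) nc c(2)] n(2) by simp
qed

end

section \<open>Regular sets of geodesic words\<close>

text \<open>\<open>K\<close> bounds the conjugators that are tested, \<open>M\<close> the
  neighbourhood of a prefix that is recorded. \<open>M\<close> covers the distance from
  \<open>quadrilateral_near\<close> with \<open>R = K\<close>; \<open>1 \<le> K\<close> puts the
  letters into \<open>B K\<close>.\<close>

locale hyp_group_radius = hyp_group +
  fixes K M :: nat
  assumes K: "1 \<le> K" and M: "2 * D + K \<le> M"
begin

text \<open>This refines the cone type of a geodesic word \<open>u\<close>: a geodesic from \<open>z\<close> to \<open>u x y\<close> passes near \<open>u\<close>
  if \<open>u x\<close> is a geodesic word and \<open>z\<close>, \<open>y\<close> are short, so these numbers determine the length of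
  \<open>z\<inverse> u x y\<close> relative to that of \<open>u\<close>.\<close>

definition level :: "'a list \<Rightarrow> 'a \<times> 'a \<Rightarrow> int" where
  "level u = (\<lambda>(z, b) \<in> B K \<times> B M. int (N (inv z \<otimes> val u \<otimes> b)) - int (length u))"

text \<open>By the triangle inequality the factors \<open>z\<close> and \<open>b\<close> change the
  norm by at most \<open>K + M\<close>.\<close>

lemma finite_levels: "finite (level ` Collect geo)"
proof (rule finite_subset)
  show "level ` Collect geo \<subseteq> (B K \<times> B M) \<rightarrow>\<^sub>E {- int (K + M)..int (K + M)}"
  proof (rule image_subsetI)
    fix u assume "u \<in> Collect geo"
    then have u: "geo u"
      by simp
    have "int (N (inv z \<otimes> val u \<otimes> b)) - int (length u) \<in> {- int (K + M)..int (K + M)}"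
      if zb: "z \<in> B K" "b \<in> B M" for z b
    proof -
      have c: "z \<in> carrier G" "b \<in> carrier G" "val u \<in> carrier G"
        using u zb by (auto simp: geo_lists dest: B_closed)
      have "N (inv z \<otimes> val u \<otimes> b) \<le> N z + N (val u) + N b"
        using N_mult[of "inv z \<otimes> val u" b] N_mult[of "inv z" "val u"] c by simp
      moreover have "z \<otimes> (inv z \<otimes> val u \<otimes> b) \<otimes> inv b = val u"
        using c by (simp add: m_assoc)
      then have "N (val u) \<le> N z + N (inv z \<otimes> val u \<otimes> b) + N b"
        using N_mult[of "z \<otimes> (inv z \<otimes> val u \<otimes> b)" "inv b"] N_mult[of z "inv z \<otimes> val u \<otimes> b"] c by simp
      ultimately show ?thesis
        using u zb by (simp add: geo_def B_def)
    qed
    then show "level u \<in> (B K \<times> B M) \<rightarrow>\<^sub>E {- int (K + M)..int (K + M)}"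
      unfolding level_def by (intro restrict_PiE_iff[THEN iffD2] ballI) (simp only: split_paired_all prod.case mem_Times_iff fst_conv snd_conv)
  qed
  show "finite ((B K \<times> B M) \<rightarrow>\<^sub>E {- int (K + M)..int (K + M)})"
    by (intro finite_PiE finite_SigmaI finite_B) auto
qed

text \<open>The part of the geodesic after its point near \<open>u\<close> does not change when
  \<open>u\<close> is replaced by \<open>v\<close>, and the part before it is measured by
  \<open>level\<close>. The resulting path for \<open>v\<close> need not be geodesic, whence only an
  inequality.\<close>

lemma level_le:
  assumes ux: "geo (u @ x)" and v: "v \<in> lists A" and eq: "level u = level v"
    and z: "z \<in> B K" and y: "y \<in> B K"
  shows "int (N (inv z \<otimes> val (v @ x) \<otimes> y)) - int (length v)
    \<le> int (N (inv z \<otimes> val (u @ x) \<otimes> y)) - int (length u)"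
proof -
  have w: "u \<in> lists A" "x \<in> lists A"
    using geo_appendD[OF ux] by (simp_all add: geo_lists)
  then have c: "val u \<in> carrier G" "val x \<in> carrier G" "val v \<in> carrier G" "z \<in> carrier G" "y \<in> carrier G"
    using v z y by (simp_all add: B_closed)
  define q where "q = val (u @ x) \<otimes> y"
  have q: "q \<in> carrier G"
    using w c by (simp add: q_def)
  \<comment> \<open>In the quadrilateral \<open>\<one>\<close>, \<open>val (u @ x)\<close>,
    \<open>q\<close>, \<open>z\<close> two opposite sides have length at most
    \<open>K\<close>.\<close>
  have "d (val (u @ x)) q \<le> K" "d z \<one> \<le> K"
    using z y w c d_sym[of z \<one>] by (simp_all add: q_def d_mult_right d_one B_def)
  then obtain n where n: "n \<in> interval q z" "d (val u) n \<le> 2 * D + K"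
    using quadrilateral_near[of \<one> "val (u @ x)" q z "val u" K] geo_interval[OF ux] q w c by auto
  have nc: "n \<in> carrier G"
    using n(1) by (rule interval_closed)
  define b where "b = inv (val u) \<otimes> n"
  have b: "b \<in> carrier G" "b \<in> B M" "n = val u \<otimes> b"
    using nc c n(2) M by (simp_all add: b_def B_def d_def)
  have "N (inv z \<otimes> q) = N (inv z \<otimes> n) + N (inv n \<otimes> q)"
    using n(1) d_sym[of q n] d_sym[of n z] d_sym[of q z] q c nc by (simp add: interval_def d_def)
  moreover have "inv z \<otimes> q = inv z \<otimes> val (u @ x) \<otimes> y" "inv z \<otimes> n = inv z \<otimes> val u \<otimes> b"
    "inv n \<otimes> q = inv b \<otimes> val x \<otimes> y"
    using w c b by (simp_all add: q_def m_assoc inv_mult_group)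
  moreover have "(inv z \<otimes> val v \<otimes> b) \<otimes> (inv b \<otimes> val x \<otimes> y) = inv z \<otimes> val (v @ x) \<otimes> y"
    using v w c b(1) by (simp add: m_assoc)
  then have "N (inv z \<otimes> val (v @ x) \<otimes> y) \<le> N (inv z \<otimes> val v \<otimes> b) + N (inv b \<otimes> val x \<otimes> y)"
    using N_mult[of "inv z \<otimes> val v \<otimes> b" "inv b \<otimes> val x \<otimes> y"] c b(1) by simp
  moreover have "int (N (inv z \<otimes> val u \<otimes> b)) - int (length u) = int (N (inv z \<otimes> val v \<otimes> b)) - int (length v)"
    using fun_cong[OF eq, of "(z, b)"] z b(2) by (simp add: level_def)
  ultimately show ?thesis
    by (simp only: of_nat_add)
qed

text \<open>Equal levels give equal cone types. Letters are appended one at a time: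
  \<open>level_le\<close> with \<open>z = \<one>\<close>, \<open>y = a\<close> and the roles of
  \<open>u\<close> and \<open>v\<close> exchanged bounds the norm of the new word from
  below.\<close>

lemma level_geo:
  assumes "geo (u @ x)" "geo v" "level u = level v"
  shows "geo (v @ x)"
  using assms(1)
proof (induction x rule: rev_induct)
  case Nil
  then show ?case using assms(2) by simp
next
  case (snoc a x)
  then have "geo (u @ x)"
    using geo_appendD(1)[of "u @ x" "[a]"] by simp
  then have vx: "geo (v @ x)"
    by (rule snoc.IH)
  have u: "u \<in> lists A" "x \<in> lists A" "a \<in> A" and v: "v \<in> lists A"
    using geo_lists[OF snoc.prems] geo_lists[OF assms(2)] by auto
  have "\<one> \<in> B K" "a \<in> B K"
    using u(3) K N_letter[of a] by (auto simp: B_def)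
  then have "int (N (val (u @ x) \<otimes> a)) - int (length u) \<le> int (N (val (v @ x) \<otimes> a)) - int (length v)"
    using level_le[OF vx u(1) assms(3)[symmetric], of \<one> a] u v by simp
  moreover have "N (val (u @ x @ [a])) = length (u @ x @ [a])"
    using snoc.prems by (rule geo_length)
  moreover have "val (u @ x @ [a]) = val (u @ x) \<otimes> a"
    using u by (simp add: m_assoc)
  moreover have "val (v @ x) \<otimes> a = val (v @ x @ [a])"
    using u v by (simp add: m_assoc)
  ultimately have "length (v @ x @ [a]) \<le> N (val (v @ x @ [a]))"
    by simp
  then show ?case
    using N_val_le[of "v @ x @ [a]"] u v by (simp add: geo_def)
qed

text \<open>Non-geodesic prefixes form a single class, since none of their extensions is geodesic.
  For geodesic prefixes the level is recorded along with \<open>f\<close>, so both extensions may be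
  assumed geodesic.\<close>

lemma regular_languageI_geo:
  assumes "\<And>w. w \<in> L \<Longrightarrow> geo w" "finite (f ` Collect geo)"
    and L: "\<And>u v x. \<lbrakk>geo (u @ x); geo (v @ x); level u = level v; f u = f v; u @ x \<in> L\<rbrakk> \<Longrightarrow> v @ x \<in> L"
  shows "regular_language A L"
proof (rule regular_languageI)
  define F where "F u = (if geo u then Some (level u, f u) else None)" for u
  have "F ` lists A \<subseteq> insert None (Some ` (level ` Collect geo \<times> f ` Collect geo))"
    by (auto simp: F_def)
  then show "finite (F ` lists A)"
    by (rule finite_subset) (intro finite.insertI finite_imageI finite_SigmaI finite_levels assms(2))
  fix u v x assume *: "F u = F v" "u @ x \<in> L"
  have "geo (u @ x)"
    using *(2) by (rule assms(1))
  moreover from this have "geo u"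
    by (rule geo_appendD)
  with *(1) have v: "geo v" "level u = level v" "f u = f v"
    by (simp_all add: F_def split: if_splits)
  ultimately show "v @ x \<in> L"
    using L[OF _ _ v(2,3) *(2)] level_geo[of u x v] by simp
qed (use finite_letters assms(1) geo_lists in auto)

definition locally_minimal :: "'a list set" where
  "locally_minimal = {w. geo w \<and> (\<forall>z \<in> B K. length w \<le> N (conjugate z (val w)))}"

text \<open>Conjugation by \<open>z\<close> is the case \<open>y = z\<close> of
  \<open>level_le\<close>, so the level alone decides and \<open>f\<close> can be constant.\<close>

lemma regular_locally_minimal: "regular_language A locally_minimal"
proof (rule regular_languageI_geo[where f = "\<lambda>_. ()"])
  fix u v x
  assume *: "geo (u @ x)" "geo (v @ x)" "level u = level v" "u @ x \<in> locally_minimal"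
  have "length (v @ x) \<le> N (conjugate z (val (v @ x)))" if z: "z \<in> B K" for z
  proof -
    have "length (u @ x) \<le> N (conjugate z (val (u @ x)))"
      using *(4) z by (simp add: locally_minimal_def)
    moreover have "u \<in> lists A"
      using geo_lists[OF *(1)] by simp
    ultimately show ?thesis
      using level_le[OF *(2) _ *(3)[symmetric] z z] by (simp add: conjugate_def)
  qed
  with *(2) show "v @ x \<in> locally_minimal"
    by (simp add: locally_minimal_def)
qed (auto simp: locally_minimal_def)

definition short_conj :: "'a set \<Rightarrow> 'a list set" where
  "short_conj H = {w. geo w \<and> (\<exists>z \<in> B K. conjugate z (val w) \<in> H)}"

text \<open>If \<open>z\<close> conjugates \<open>u x\<close> into \<open>H\<close>, then
  \<open>u x z\<close> lies in the coset \<open>z H\<close>. A geodesic from \<open>z\<close> to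
  this point passes near \<open>u\<close> and, by quasiconvexity, stays near the coset; so
  \<open>u\<close> is within \<open>M\<close> of the coset, and \<open>f u\<close> records the coset
  points there.\<close>

lemma regular_short_conj:
  assumes H: "subgroup H G"
    and qc: "\<And>u v m. \<lbrakk>u \<in> H; v \<in> H; m \<in> interval u v\<rbrakk> \<Longrightarrow> \<exists>h \<in> H. d m h \<le> k"
    and k: "2 * D + K + k \<le> M"
  shows "regular_language A (short_conj H)"
proof -
  define f where "f u = {(z, b) \<in> B K \<times> B M. inv z \<otimes> val u \<otimes> b \<in> H}" for u
  have HG: "h \<in> carrier G" if "h \<in> H" for h
    using subgroup.mem_carrier[OF H that] .
  show ?thesis
  proof (rule regular_languageI_geo[where f = f])
    have "f ` Collect geo \<subseteq> Pow (B K \<times> B M)"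
      by (auto simp: f_def)
    then show "finite (f ` Collect geo)"
      by (rule finite_subset) (simp add: finite_B)
    fix u v x
    assume *: "geo (u @ x)" "geo (v @ x)" "f u = f v" "u @ x \<in> short_conj H"
    have w: "u \<in> lists A" "x \<in> lists A" "v \<in> lists A"
      using geo_lists[OF *(1)] geo_lists[OF *(2)] by simp_all
    obtain z where z: "z \<in> B K" "conjugate z (val (u @ x)) \<in> H"
      using *(4) by (auto simp: short_conj_def)
    have c: "z \<in> carrier G" "val u \<in> carrier G" "val v \<in> carrier G" "val x \<in> carrier G"
      using w z(1) by (simp_all add: B_closed)
    define h where "h = conjugate z (val (u @ x))"
    have h: "h \<in> H" "z \<otimes> h = val (u @ x) \<otimes> z"
      using z(2) c w by (simp_all add: h_def conjugate_def m_assoc)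
    have zh: "z \<otimes> h \<in> carrier G"
      using h(1) HG c by simp
    have "d (val (u @ x)) (z \<otimes> h) \<le> K" "d z \<one> \<le> K"
      using z(1) w c d_sym[of z \<one>] unfolding h(2) by (simp_all add: d_mult_right d_one B_def)
    then obtain n where n: "n \<in> interval (z \<otimes> h) z" "d (val u) n \<le> 2 * D + K"
      using quadrilateral_near[of \<one> "val (u @ x)" "z \<otimes> h" z "val u" K] geo_interval[OF *(1)] zh w c by auto
    have nc: "n \<in> carrier G"
      using n(1) by (rule interval_closed)
    have "inv z \<otimes> n \<in> interval h \<one>"
      using n(1) c HG[OF h(1)] by (intro interval_left) simp_all
    then obtain h' where h': "h' \<in> H" "d (inv z \<otimes> n) h' \<le> k"
      using qc[OF h(1) subgroup.one_closed[OF H]] by blast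
    have "d n (z \<otimes> h') \<le> k"
      using h' nc c HG d_left[of z "inv z \<otimes> n" h'] by simp
    then have "d (val u) (z \<otimes> h') \<le> M"
      using d_triangle[of "val u" n "z \<otimes> h'"] n(2) k nc c HG[OF h'(1)] by simp
    define b where "b = inv (val u) \<otimes> (z \<otimes> h')"
    have b: "b \<in> carrier G" "b \<in> B M" "inv z \<otimes> val u \<otimes> b = h'"
      using c HG[OF h'(1)] \<open>d (val u) (z \<otimes> h') \<le> M\<close> by (simp_all add: b_def B_def d_def m_assoc)
    then have "(z, b) \<in> f u"
      using z(1) h'(1) by (simp add: f_def)
    then have hv: "inv z \<otimes> val v \<otimes> b \<in> H"
      unfolding *(3) by (simp add: f_def)
    \<comment> \<open>The right-hand side does not involve \<open>u\<close>, so the same element of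
      \<open>H\<close> leads on from the coset point near \<open>v\<close>.\<close>
    have "inv h' \<otimes> h = inv b \<otimes> val x \<otimes> z"
      using c b(1) w unfolding b(3)[symmetric] by (simp add: h_def conjugate_def m_assoc inv_mult_group)
    moreover have "inv h' \<otimes> h \<in> H"
      using H h(1) h'(1) by (simp add: subgroup.m_closed subgroup.m_inv_closed)
    ultimately have "(inv z \<otimes> val v \<otimes> b) \<otimes> (inv b \<otimes> val x \<otimes> z) \<in> H"
      using H hv by (simp add: subgroup.m_closed)
    moreover have "(inv z \<otimes> val v \<otimes> b) \<otimes> (inv b \<otimes> val x \<otimes> z) = conjugate z (val (v @ x))"
      using c b(1) w by (simp add: conjugate_def m_assoc)
    ultimately show "v @ x \<in> short_conj H"
      using *(2) z(1) by (auto simp: short_conj_def)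
  qed (auto simp: short_conj_def)
qed

text \<open>A smaller word \<open>s\<close> for \<open>u x\<close> may be smaller already in its
  first \<open>length u\<close> letters; then \<open>bigon\<close> keeps this prefix of
  \<open>s\<close> close to \<open>u\<close>, and \<open>f u\<close> records its end point relative
  to \<open>u\<close>. Otherwise \<open>s\<close> begins with \<open>u\<close>, and only
  \<open>x\<close> is compared.\<close>

lemma regular_lex_reducible: "regular_language A (lex_reducible R)"
proof -
  define f where
    "f u = {b \<in> B M. \<exists>t \<in> lists A. length t = length u \<and> val t = val u \<otimes> b \<and> (t, u) \<in> lex R}" for u
  show ?thesis
  proof (rule regular_languageI_geo[where f = f])
    have "f ` Collect geo \<subseteq> Pow (B M)"
      by (auto simp: f_def)
    then show "finite (f ` Collect geo)"
      by (rule finite_subset) (simp add: finite_B)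
    fix u v x
    assume *: "geo (u @ x)" "geo (v @ x)" "f u = f v" "u @ x \<in> lex_reducible R"
    have w: "u \<in> lists A" "x \<in> lists A" "v \<in> lists A"
      using geo_lists[OF *(1)] geo_lists[OF *(2)] by simp_all
    obtain s where s: "s \<in> lists A" "length s = length (u @ x)" "val s = val (u @ x)" "(s, u @ x) \<in> lex R"
      using *(4) by (auto simp: lex_reducible_def)
    define t y where "t = take (length u) s" and "y = drop (length u) s"
    have ty: "s = t @ y" "length t = length u" "length y = length x"
      using s(2) by (auto simp: t_def y_def)
    have ty_lists: "t \<in> lists A" "y \<in> lists A"
      using s(1) unfolding ty(1) by simp_all
    have "\<exists>s' \<in> lists A. length s' = length (v @ x) \<and> val s' = val (v @ x) \<and> (s', v @ x) \<in> lex R"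
    proof (cases "(t, u) \<in> lex R")
      case True
      have "geo (t @ y)"
        using *(1) s(1-3) unfolding ty(1) geo_def by (simp only: simp_thms)
      then have t: "val t \<in> interval \<one> (val (u @ x))" "N (val t) = length u"
        using geo_interval[of t y] geo_length[OF geo_appendD(1)[of t y]] s(3) ty by simp_all
      moreover have "val u \<in> interval \<one> (val (u @ x))" "N (val u) = length u"
        by (rule geo_interval[OF *(1)], rule geo_length[OF geo_appendD(1)[OF *(1)]])
      ultimately have "d (val u) (val t) \<le> 2 * D"
        using bigon[of \<one> "val (u @ x)" "val u" "val t"] w ty_lists by (simp add: d_one)
      define b where "b = inv (val u) \<otimes> val t"
      have b: "b \<in> B M" "b \<in> carrier G" "val t = val u \<otimes> b"
        using \<open>d (val u) (val t) \<le> 2 * D\<close> M w ty_lists by (simp_all add: b_def B_def d_def)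
      then have "b \<in> f u"
        using True ty_lists ty(2) by (auto simp: f_def)
      then obtain t' where t': "t' \<in> lists A" "length t' = length v" "val t' = val v \<otimes> b" "(t', v) \<in> lex R"
        unfolding *(3) by (auto simp: f_def)
      have "val u \<otimes> (b \<otimes> val y) = val u \<otimes> val x"
        using s(3) ty(1) ty_lists w b by (simp add: m_assoc)
      then have "b \<otimes> val y = val x"
        using w ty_lists b(2) by simp
      then have "val (t' @ y) = val (v @ x)"
        using t' ty_lists w b(2) by (simp add: m_assoc)
      then show ?thesis
        using t' ty_lists ty(3) by (intro bexI[of _ "t' @ y"]) (simp_all add: lex_append_rightI)
    next
      case False
      then have "t = u" "(y, x) \<in> lex R"
        using lex_append_cases[of t u y x R] s(4) ty by auto
      moreover from this have "val y = val x"
        using s(3) ty(1) ty_lists w by simp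
      ultimately show ?thesis
        using ty_lists ty(3) w by (intro bexI[of _ "v @ y"]) (simp_all add: lex_append_leftI)
    qed
    then show "v @ x \<in> lex_reducible R"
      using *(2) by (simp add: lex_reducible_def)
  qed (auto simp: lex_reducible_def)
qed

end

section \<open>Conjugating a long word into a set by a short element\<close>

lemma cyclic_closure_trans:
  assumes "x \<in> cyclic_closure {w}" "y \<in> cyclic_closure {x}"
  shows "y \<in> cyclic_closure {w}"
proof -
  obtain u v where uv: "w = u @ v" "x = v @ u"
    using assms(1) by (auto simp: cyclic_closure_def)
  obtain p q where pq: "x = p @ q" "y = q @ p"
    using assms(2) by (auto simp: cyclic_closure_def)
  from uv(2) pq(1) consider t where "v = p @ t" "t @ u = q" | t where "v @ t = p" "u = t @ q"
    by (auto simp: append_eq_append_conv2)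
  then show ?thesis
  proof cases
    case 1
    then show ?thesis
      using uv(1) pq(2) by (auto simp: cyclic_closure_def intro: exI[of _ "u @ p"] exI[of _ t])
  next
    case 2
    then show ?thesis
      using uv(1) pq(2) by (auto simp: cyclic_closure_def intro: exI[of _ t] exI[of _ "q @ v"])
  qed
qed

lemma in_cyclic_closure_iff: "w \<in> cyclic_closure L \<longleftrightarrow> (\<exists>x \<in> L. x \<in> cyclic_closure {w})"
  by (auto simp: cyclic_closure_def)

lemma cyclic_closure_lists: "x \<in> cyclic_closure {w} \<Longrightarrow> x \<in> lists A \<longleftrightarrow> w \<in> lists A"
  by (auto simp: cyclic_closure_def)

lemma cyclic_closure_length: "x \<in> cyclic_closure {w} \<Longrightarrow> length x = length w"
  by (auto simp: cyclic_closure_def)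

lemma (in fg_group) cyclic_closure_conjugate:
  assumes "w \<in> lists A" "x \<in> cyclic_closure {w}"
  obtains g where "g \<in> carrier G" "val x = conjugate g (val w)"
proof -
  obtain u v where "w = u @ v" "x = v @ u"
    using assms(2) by (auto simp: cyclic_closure_def)
  then show thesis
    using assms(1) val_rotate[of u v] that[of "val u"] by simp
qed

text \<open>Take a conjugator \<open>z\<close> of least length over all cyclic permutations \<open>x\<close> of \<open>w\<close>, and consider the
  quadrilateral \<open>\<one>\<close>, \<open>x\<close>, \<open>x z\<close>, \<open>z\<close>. A point \<open>m\<close> in the middle of the side \<open>x\<close> is close to one of the
  other sides. Every \<open>y\<close> that conjugates \<open>x\<close> into \<open>C\<close> yields the conjugator \<open>m\<inverse> y\<close> of the cyclic
  permutation of \<open>x\<close> starting at \<open>m\<close>, so \<open>m\<close> is at distance at least the length of \<open>z\<close> from \<open>y\<close>. If \<open>m\<close>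
  were close to a side \<open>z\<close>, it would thus be close to an end point of \<open>x\<close>; so it is close to the side
  from \<open>z\<close> to \<open>x z\<close>, which bounds the length of \<open>z\<close>.\<close>

lemma (in hyp_group) conjugate_into:
  assumes C: "C \<subseteq> carrier G"
    and near: "\<And>c n. \<lbrakk>c \<in> C; n \<in> interval \<one> c\<rbrakk> \<Longrightarrow> \<exists>p \<in> carrier G. d n p \<le> k \<and> conjugate p c \<in> C"
    and geo: "\<And>x. x \<in> cyclic_closure {w} \<Longrightarrow> geo x"
    and len: "8 * D + 2 \<le> length w"
    and g: "g \<in> carrier G" "conjugate g (val w) \<in> C"
  shows "\<exists>x \<in> cyclic_closure {w}. \<exists>z \<in> B (2 * D + k). conjugate z (val x) \<in> C"
proof -
  let ?P = "\<lambda>n. \<exists>x \<in> cyclic_closure {w}. \<exists>z \<in> carrier G. N z = n \<and> conjugate z (val x) \<in> C"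
  define l where "l = (LEAST n. ?P n)"
  have "w \<in> cyclic_closure {w}"
    by (auto simp: cyclic_closure_def)
  then have "?P (N g)"
    using g by blast
  then have "?P l"
    unfolding l_def by (rule LeastI)
  then obtain x z where x: "x \<in> cyclic_closure {w}" and z: "z \<in> carrier G" "N z = l" "conjugate z (val x) \<in> C"
    by blast
  \<comment> \<open>Both parts have at least \<open>4 * D + 1\<close> letters, which is where the
    bound \<open>8 * D + 2\<close> comes from; so \<open>m\<close> is more than \<open>4 * D\<close>
    away from \<open>\<one>\<close> and from \<open>a\<close>.\<close>
  define p q where "p = take (4 * D + 1) x" and "q = drop (4 * D + 1) x"
  have pq: "x = p @ q" "length p = 4 * D + 1" "4 * D < length q"
    using len cyclic_closure_length[OF x] by (simp_all add: p_def q_def)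
  have geo_pq: "geo (p @ q)"
    using geo[OF x] pq(1) by simp
  have pq_lists: "p \<in> lists A" "q \<in> lists A"
    using geo_lists[OF geo_pq] by simp_all
  define a m where "a = val x" and "m = val p"
  have am: "a \<in> carrier G" "m \<in> carrier G" "a = m \<otimes> val q"
    using pq_lists pq(1) by (simp_all add: a_def m_def)
  have "N m = 4 * D + 1"
    using geo_length[OF geo_appendD(1)[OF geo_pq]] pq(2) by (simp add: m_def)
  then have m1: "d m \<one> = 4 * D + 1"
    using d_sym[of m \<one>] am by (simp add: d_one)
  have ma: "4 * D < d m a"
    using geo_length[OF geo_appendD(2)[OF geo_pq]] pq(3) am pq_lists by (simp add: d_mult_right)
  have minimal: "l \<le> d m y" if y: "y \<in> carrier G" "conjugate y a \<in> C" for y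
  proof -
    have "q @ p \<in> cyclic_closure {x}"
      using pq(1) by (auto simp: cyclic_closure_def)
    then have "q @ p \<in> cyclic_closure {w}"
      by (rule cyclic_closure_trans[OF x])
    moreover have "val (q @ p) = conjugate m a"
      using val_rotate[OF pq_lists] by (simp add: a_def m_def pq(1))
    then have "conjugate (inv m \<otimes> y) (val (q @ p)) = conjugate y a"
      using am(1,2) y(1) by (simp flip: conjugate_mult)
    ultimately have "?P (d m y)"
      using y am by (intro bexI[of _ "q @ p"] bexI[of _ "inv m \<otimes> y"]) (simp_all add: d_def)
    then show ?thesis
      unfolding l_def by (rule Least_le)
  qed
  define c where "c = conjugate z a"
  have c: "c \<in> C" "c \<in> carrier G" "z \<otimes> c = a \<otimes> z"
    using z am by (simp_all add: c_def a_def conjugate_def m_assoc)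
  \<comment> \<open>As \<open>a\<close> commutes with itself, \<open>a \<otimes> z\<close> is a
    conjugator as well as \<open>z\<close>; thus \<open>minimal\<close> applies to both ends of the
    far side.\<close>
  have "conjugate (a \<otimes> z) a = c"
    using z am by (simp add: c_def conjugate_def m_assoc inv_mult_group)
  have "m \<in> interval \<one> a"
    using geo_interval[OF geo_pq] by (simp add: a_def m_def pq(1))
  then obtain n where n: "n \<in> interval a (a \<otimes> z) \<union> interval (a \<otimes> z) z \<union> interval z \<one>" "d m n \<le> 2 * D"
    using quadrilateral[of \<one> a "a \<otimes> z" z m] am z(1) by auto
  have nc: "n \<in> carrier G"
    using n(1) by (auto dest: interval_closed)
  consider "n \<in> interval a (a \<otimes> z)" | "n \<in> interval z (a \<otimes> z)" | "n \<in> interval z \<one>"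
    using n(1) interval_sym[of "a \<otimes> z" z] am z(1) by auto
  then have "l \<le> 2 * D + k"
  proof cases
    case 1
    \<comment> \<open>The way from \<open>m\<close> through \<open>n\<close> to
      \<open>a \<otimes> z\<close> has length at least \<open>l\<close>, so \<open>n\<close> is
      within \<open>2 * D\<close> of \<open>a\<close>, and \<open>m\<close> within
      \<open>4 * D\<close>, a contradiction.\<close>
    have "d a n + d n (a \<otimes> z) = l"
      using 1 am z(1,2) by (simp add: interval_def d_mult_right)
    moreover have "l \<le> d m (a \<otimes> z)"
      using minimal[of "a \<otimes> z"] \<open>conjugate (a \<otimes> z) a = c\<close> c(1) am z(1) by simp
    moreover have "d m (a \<otimes> z) \<le> d m n + d n (a \<otimes> z)" "d m a \<le> d m n + d n a"
      using am nc z(1) by (simp_all add: d_triangle)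
    ultimately have False
      using n(2) ma d_sym[OF am(1) nc] by simp
    then show ?thesis ..
  next
    case 2
    \<comment> \<open>Translation by \<open>inv z\<close> moves the far side to an interval from
      \<open>\<one>\<close> to \<open>c\<close>, to which \<open>near\<close> applies.\<close>
    have "inv z \<otimes> n \<in> interval \<one> c"
      using 2 c z(1) by (intro interval_left) simp_all
    then obtain p where p: "p \<in> carrier G" "d (inv z \<otimes> n) p \<le> k" "conjugate p c \<in> C"
      using near c(1) by blast
    have "l \<le> d m (z \<otimes> p)"
      using minimal[of "z \<otimes> p"] p z(1) am(1) by (simp add: conjugate_mult c_def)
    also have "\<dots> \<le> d m n + d n (z \<otimes> p)"
      using am nc z(1) p(1) by (intro d_triangle) simp_all
    also have "d n (z \<otimes> p) \<le> k"
      using d_left[of z "inv z \<otimes> n" p] p nc z(1) by simp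
    finally show ?thesis
      using n(2) by simp
  next
    case 3
    have "d z n + d n \<one> = l"
      using 3 z(1,2) d_sym[of z \<one>] by (simp add: interval_def d_one)
    moreover have "l \<le> d m z"
      using minimal[of z] z am(1) by (simp add: a_def)
    moreover have "d m z \<le> d m n + d n z" "d m \<one> \<le> d m n + d n \<one>"
      using am nc z(1) by (simp_all add: d_triangle)
    ultimately have False
      using n(2) m1 d_sym[OF z(1) nc] by simp
    then show ?thesis ..
  qed
  then show ?thesis
    using x z by (intro bexI[of _ x] bexI[of _ z]) (simp_all add: B_def)
qed

section \<open>Regularity of the conjugacy languages\<close>

lemma (in hyp_group) regular_ConjGeo:
  assumes H: "subgroup H G" and qc: "quasiconvex G X H"
  shows "regular_language A (ConjGeo G X H)"
proof -
  have HG: "H \<subseteq> carrier G"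
    using subgroup.subset[OF H] .
  obtain k where k: "\<And>u v m. \<lbrakk>u \<in> H; v \<in> H; m \<in> interval u v\<rbrakk> \<Longrightarrow> \<exists>h \<in> H. d m h \<le> k"
    using quasiconvex_interval[OF qc HG] by blast
  \<comment> \<open>\<open>2 * D + k\<close> is the bound that \<open>conjugate_into\<close> gives
    for \<open>H\<close>; the summand 1 ensures \<open>1 \<le> K\<close>.\<close>
  define K where "K = 2 * D + k + 1"
  interpret hyp_group_radius G X D K "2 * D + K + k"
    by unfold_locales (simp_all add: K_def)
  have B_K: "B (2 * D + k) \<subseteq> B K" "B (2 * D) \<subseteq> B K"
    by (auto simp: B_def K_def)
  \<comment> \<open>Complements before and after \<open>cyclic_closure\<close> express that all
    cyclic permutations are locally minimal.\<close>
  define L where "L = (lists A - cyclic_closure (lists A - locally_minimal)) \<inter> cyclic_closure (short_conj H)"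
  have "regular_language A L"
    unfolding L_def
    by (intro regular_language_Int regular_language_compl regular_language_cyclic_closure
        regular_locally_minimal regular_short_conj[OF H k]) simp_all
  moreover have "w \<in> ConjGeo G X H \<longleftrightarrow> w \<in> L" if w: "w \<in> lists A" "8 * D + 2 \<le> length w" for w
  proof -
    have cyc: "x \<in> lists A" "length x = length w" "conj_norm G X (val x) = conj_norm G X (val w)"
      if x: "x \<in> cyclic_closure {w}" for x
    proof -
      show "x \<in> lists A" "length x = length w"
        using cyclic_closure_lists[OF x] cyclic_closure_length[OF x] w(1) by simp_all
      obtain g where "g \<in> carrier G" "val x = conjugate g (val w)"
        by (rule cyclic_closure_conjugate[OF w(1) x])
      then show "conj_norm G X (val x) = conj_norm G X (val w)"
        using w(1) by (simp add: conj_norm_conjugate)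
    qed
    have L_iff: "w \<in> L \<longleftrightarrow> cyclic_closure {w} \<subseteq> locally_minimal \<and> (\<exists>x \<in> short_conj H. x \<in> cyclic_closure {w})"
      using w(1) cyc(1) in_cyclic_closure_iff[of w "lists A - locally_minimal"]
        in_cyclic_closure_iff[of w "short_conj H"] unfolding L_def by blast
    show ?thesis
    proof
      assume "w \<in> ConjGeo G X H"
      then have len: "length w = conj_norm G X (val w)" and "val w \<in> conj_closure G H"
        by (simp_all add: ConjGeo_def)
      then obtain g where g: "g \<in> carrier G" "conjugate g (val w) \<in> H"
        using conj_closure_iff[OF _ HG] w(1) by auto
      \<comment> \<open>Cyclic permutations share length and conjugacy norm with \<open>w\<close>,
        so no conjugator shortens them; \<open>z = \<one>\<close> shows that they are
        geodesic.\<close>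
      have min: "length x \<le> N (conjugate z (val x))" if "x \<in> cyclic_closure {w}" "z \<in> carrier G" for x z
        using conj_norm_le[OF that(2), of "val x"] cyc[OF that(1)] len by simp
      have geo: "geo x" if "x \<in> cyclic_closure {w}" for x
        using min[OF that, of \<one>] cyc(1)[OF that] N_val_le[of x] by (simp add: geo_def)
      have "cyclic_closure {w} \<subseteq> locally_minimal"
        using min geo by (auto simp: locally_minimal_def dest: B_closed)
      moreover have "\<exists>x \<in> cyclic_closure {w}. \<exists>z \<in> B (2 * D + k). conjugate z (val x) \<in> H"
      proof (rule conjugate_into[OF HG _ geo w(2) g])
        fix c n assume c: "c \<in> H" and n: "n \<in> interval \<one> c"
        \<comment> \<open>Quasiconvexity provides a point of \<open>H\<close> near \<open>n\<close>,
          and conjugation by it preserves \<open>H\<close>.\<close>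
        obtain h where h: "h \<in> H" "d n h \<le> k"
          using k[OF subgroup.one_closed[OF H] c n] by blast
        then show "\<exists>p \<in> carrier G. d n p \<le> k \<and> conjugate p c \<in> H"
          using H c HG by (intro bexI[of _ h])
            (auto simp: conjugate_def intro!: subgroup.m_closed subgroup.m_inv_closed)
      qed
      then have "\<exists>x \<in> short_conj H. x \<in> cyclic_closure {w}"
        using geo B_K(1) unfolding short_conj_def by blast
      ultimately show "w \<in> L"
        unfolding L_iff by blast
    next
      assume "w \<in> L"
      then obtain x where loc: "cyclic_closure {w} \<subseteq> locally_minimal"
        and x: "x \<in> short_conj H" "x \<in> cyclic_closure {w}"
        unfolding L_iff by blast
      have geo: "geo y" if "y \<in> cyclic_closure {w}" for y
        using loc that by (auto simp: locally_minimal_def)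
      obtain z where z: "z \<in> carrier G" "conjugate z (val x) \<in> H"
        using x(1) by (auto simp: short_conj_def dest: B_closed)
      obtain g where g: "g \<in> carrier G" "val x = conjugate g (val w)"
        by (rule cyclic_closure_conjugate[OF w(1) x(2)])
      have "conjugate (g \<otimes> z) (val w) \<in> H"
        using g z w(1) by (simp add: conjugate_mult)
      then have "val w \<in> conj_closure G H"
        using conj_closure_iff[OF val_closed[OF w(1)] HG] m_closed[OF g(1) z(1)] by blast
      moreover have "length w \<le> conj_norm G X (val w)"
      proof -
        \<comment> \<open>Elements that are shortest in their conjugacy class, of the norm expected
          for \<open>w\<close>. A bounded conjugator from a cyclic permutation of \<open>w\<close>
          into \<open>C\<close> contradicts local minimality unless \<open>w\<close> has this length
          already.\<close>
        define C where "C = {a \<in> carrier G. conj_norm G X a = conj_norm G X (val w) \<and> N a = conj_norm G X a}"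
        obtain h where h: "h \<in> carrier G" "N (conjugate h (val w)) = conj_norm G X (val w)"
          by (rule conj_norm_attained[OF val_closed[OF w(1)]])
        have "\<exists>x \<in> cyclic_closure {w}. \<exists>z \<in> B (2 * D + 0). conjugate z (val x) \<in> C"
        proof (rule conjugate_into[OF _ _ geo w(2) h(1)])
          fix c n assume c: "c \<in> C" and n: "n \<in> interval \<one> c"
          have cn: "c \<in> carrier G" "n \<in> carrier G"
            using c interval_closed[OF n] by (simp_all add: C_def)
          \<comment> \<open>Conjugation by a point \<open>n\<close> of a geodesic from
            \<open>\<one>\<close> to \<open>c\<close> amounts to a cyclic permutation and does not
            increase the norm; hence \<open>near\<close> holds with \<open>p = n\<close> and
            distance 0.\<close>
          have "N (conjugate n c) \<le> N (inv n \<otimes> c) + N n"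
            using N_mult[of "inv n \<otimes> c" n] cn by (simp add: conjugate_def)
          also have "\<dots> = N c"
            using n cn by (simp add: interval_def d_one d_def)
          finally have "N (conjugate n c) = conj_norm G X c"
            using conj_norm_le[OF cn(2), of c] c by (simp add: C_def)
          then show "\<exists>p \<in> carrier G. d n p \<le> 0 \<and> conjugate p c \<in> C"
            using cn c by (intro bexI[of _ n]) (simp_all add: C_def conj_norm_conjugate)
        qed (use h w(1) in \<open>auto simp: C_def conj_norm_conjugate\<close>)
        then obtain y z where yz: "y \<in> cyclic_closure {w}" "z \<in> B (2 * D)" "conjugate z (val y) \<in> C"
          by auto
        then have "y \<in> locally_minimal" "z \<in> B K"
          using loc B_K(2) by auto
        then have "length w \<le> N (conjugate z (val y))"
          using cyc(2)[OF yz(1)] by (simp add: locally_minimal_def)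
        then show ?thesis
          using yz(3) by (simp add: C_def)
      qed
      moreover have "conj_norm G X (val w) \<le> length w"
        using conj_norm_le[of \<one> "val w"] N_val_le[OF w(1)] w(1) by simp
      ultimately show "w \<in> ConjGeo G X H"
        using w(1) by (simp add: ConjGeo_def)
    qed
  qed
  ultimately show ?thesis
    by (rule regular_language_eventually) (auto simp: ConjGeo_def)
qed

section \<open>Shortlex representatives\<close>

lemma (in fg_group) total_lenlex_words:
  assumes r: "linear_order_on A r" and "u \<in> lists A" "v \<in> lists A" "u \<noteq> v"
  shows "(u, v) \<in> lenlex (r - Id) \<or> (v, u) \<in> lenlex (r - Id)"
proof -
  have tot: "total_on A r"
    using r by (simp add: linear_order_on_def)
  have "(u, v) \<in> lex (r - Id) \<or> (v, u) \<in> lex (r - Id)" if "length u = length v"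
    using that assms(2-4)
    by (induction u v rule: list_induct2) (use tot in \<open>auto simp: total_on_def\<close>)
  then show ?thesis
    unfolding lenlex_conv by (metis (mono_tags, lifting) case_prodI linorder_neqE_nat mem_Collect_eq)
qed

lemma (in fg_group) wf_lenlex_words:
  assumes "linear_order_on A r"
  shows "wf (lenlex (r - Id))"
proof -
  have r: "partial_order_on A r"
    using assms by (simp add: linear_order_on_def)
  have "finite r"
    by (rule finite_subset[OF partial_order_onD(4)[OF r]]) (intro finite_SigmaI finite_letters)
  then show ?thesis
    using partial_order_on_acyclic[OF r] by (intro wf_lenlex finite_acyclic_wf) simp_all
qed

text \<open>Well-foundedness gives a minimal representative, totality makes it least and asymmetry
  unique, so the definite description denotes it.\<close>

lemma (in fg_group) shortlex_rep:
  assumes r: "linear_order_on A r" and g: "g \<in> carrier G"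
  shows "shortlex_rep G X r g \<in> representatives G X g"
    and "v \<in> representatives G X g \<Longrightarrow> v = shortlex_rep G X r g \<or> (shortlex_rep G X r g, v) \<in> lenlex (r - Id)"
proof -
  let ?R = "representatives G X g" and ?S = "lenlex (r - Id)"
  let ?least = "\<lambda>w. w \<in> ?R \<and> (\<forall>v \<in> ?R. v = w \<or> (w, v) \<in> ?S)"
  obtain w where "w \<in> ?R"
    using ex_word[OF g] by (auto simp: representatives_def)
  then obtain m where m: "m \<in> ?R" "\<And>v. (v, m) \<in> ?S \<Longrightarrow> v \<notin> ?R"
    using wf_lenlex_words[OF r] by (meson wfE_min)
  have "?least m"
    using m total_lenlex_words[OF r, of _ m] by (auto simp: representatives_def)
  moreover have "u = v" if "?least u" "?least v" for u v
  proof (rule ccontr)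
    assume "u \<noteq> v"
    then have "(u, v) \<in> ?S" "(v, u) \<in> ?S"
      using that by auto
    then show False
      using wf_lenlex_words[OF r] by (meson wf_not_sym)
  qed
  ultimately have "?least (THE w. ?least w)"
    by (intro theI[of ?least m]) blast+
  then have "?least (shortlex_rep G X r g)"
    by (simp add: shortlex_rep_def)
  then show "shortlex_rep G X r g \<in> ?R" "v \<in> ?R \<Longrightarrow> v = shortlex_rep G X r g \<or> (shortlex_rep G X r g, v) \<in> ?S"
    by blast+
qed

lemma (in fg_group) geo_shortlex_rep:
  assumes r: "linear_order_on A r" and g: "g \<in> carrier G"
  shows "geo (shortlex_rep G X r g)" "val (shortlex_rep G X r g) = g"
proof -
  let ?w = "shortlex_rep G X r g"
  have w: "?w \<in> lists A" "val ?w = g"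
    using shortlex_rep(1)[OF r g] by (simp_all add: representatives_def)
  obtain v where v: "v \<in> lists A" "val v = g" "length v = N g"
    using g by (rule ex_geodesic_word)
  then have "v = ?w \<or> (?w, v) \<in> lenlex (r - Id)"
    by (intro shortlex_rep(2)[OF r g]) (simp add: representatives_def)
  then have "length ?w \<le> N g"
    using v(3) by (auto simp: lenlex_conv)
  then show "geo ?w" "val ?w = g"
    using N_val_le[of ?w] w by (simp_all add: geo_def)
qed

lemma (in fg_group) shortlex_rep_eq_iff:
  assumes r: "linear_order_on A r" and w: "w \<in> lists A"
  shows "w = shortlex_rep G X r (val w) \<longleftrightarrow> geo w \<and> w \<notin> lex_reducible (r - Id)"
proof
  let ?w = "shortlex_rep G X r (val w)"
  have g: "val w \<in> carrier G"
    using w by simp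
  show "geo w \<and> w \<notin> lex_reducible (r - Id)" if eq: "w = ?w"
  proof -
    have "w \<notin> lex_reducible (r - Id)"
    proof
      assume "w \<in> lex_reducible (r - Id)"
      then obtain s where "s \<in> lists A" "val s = val w" and s: "(s, w) \<in> lenlex (r - Id)"
        by (auto simp: lex_reducible_def lenlex_conv)
      then have "s = w \<or> (w, s) \<in> lenlex (r - Id)"
        using shortlex_rep(2)[OF r g, of s] eq by (simp add: representatives_def)
      then have "(w, s) \<in> lenlex (r - Id)"
        using s by blast
      then show False
        using s wf_lenlex_words[OF r] by (meson wf_not_sym)
    qed
    moreover have "geo w"
      using geo_shortlex_rep(1)[OF r g] by (simp flip: eq)
    ultimately show ?thesis
      by blast
  qed
  show "w = ?w" if "geo w \<and> w \<notin> lex_reducible (r - Id)"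
  proof -
    have "w \<in> representatives G X (val w)"
      using w by (simp add: representatives_def)
    then have "w = ?w \<or> (?w, w) \<in> lenlex (r - Id)"
      by (rule shortlex_rep(2)[OF r g])
    moreover have "length ?w = length w" "val ?w = val w" "?w \<in> lists A"
      using geo_shortlex_rep[OF r g] that by (simp_all add: geo_def)
    ultimately show ?thesis
      using that by (auto simp: lenlex_conv lex_reducible_def)
  qed
qed

text \<open>Words in \<open>ConjGeo\<close> are geodesic, as the conjugacy norm is at most the norm
  of the value, which is at most the length. Among geodesic words, those outside
  \<open>lex_reducible\<close> are the shortlex representatives.\<close>

lemma (in fg_group) ConjMinLenSL_eq:
  assumes r: "linear_order_on A r" and H: "H \<subseteq> carrier G"
  shows "ConjMinLenSL G X r H = ConjGeo G X H \<inter> (lists A - lex_reducible (r - Id))"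
proof (intro equalityI subsetI)
  fix w assume "w \<in> ConjMinLenSL G X r H"
  then obtain g where g: "w = shortlex_rep G X r g" "g \<in> conj_closure G H" "N g = conj_norm G X g"
    by (auto simp: ConjMinLenSL_def)
  have "g \<in> carrier G"
    using g(2) H by (auto simp: conj_closure_def)
  then have w: "geo w" "val w = g"
    using geo_shortlex_rep[OF r, of g] by (simp_all add: g(1))
  moreover have "w \<notin> lex_reducible (r - Id)"
    using shortlex_rep_eq_iff[OF r, of w] w g(1) geo_lists[OF w(1)] by simp
  ultimately show "w \<in> ConjGeo G X H \<inter> (lists A - lex_reducible (r - Id))"
    using g by (simp add: ConjGeo_def geo_def)
next
  fix w assume w: "w \<in> ConjGeo G X H \<inter> (lists A - lex_reducible (r - Id))"
  then have "w \<in> lists A" "length w = conj_norm G X (val w)" "val w \<in> conj_closure G H"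
    by (auto simp: ConjGeo_def)
  moreover from this have "N (val w) = conj_norm G X (val w)"
    using conj_norm_le[of \<one> "val w"] N_val_le[of w] by simp
  moreover from calculation have "w = shortlex_rep G X r (val w)"
    using w shortlex_rep_eq_iff[OF r, of w] by (simp add: geo_def)
  ultimately show "w \<in> ConjMinLenSL G X r H"
    by (auto simp: ConjMinLenSL_def)
qed

theorem theorem5p10:
  fixes G :: "('a, 'b) monoid_scheme" and X H :: "'a set" and r :: "'a rel"
  assumes "group G"
    and "finite X" and "X \<subseteq> carrier G" and "generate G X = carrier G"
    and "linear_order_on (letters G X) r"
    and "hyperbolic_group G X"
    and "subgroup H G" and "quasiconvex G X H"
  shows "regular_language (letters G X) (ConjGeo G X H) \<and>
         regular_language (letters G X) (ConjMinLenSL G X r H)"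
proof -
  interpret fg_group G X
    using assms(1-4) by (simp add: fg_group_def fg_group_axioms_def)
  obtain D where "hyp_group G X D"
    using assms(6) by (rule hyp_groupI)
  then interpret hyp_group G X D .
  \<comment> \<open>Any admissible radii serve here, since \<open>lex_reducible\<close> does not
    depend on them.\<close>
  interpret hyp_group_radius G X D 1 "2 * D + 1"
    by unfold_locales simp_all
  have "regular_language (letters G X) (ConjGeo G X H)"
    using assms(7,8) by (rule regular_ConjGeo)
  moreover from this have "regular_language (letters G X) (ConjMinLenSL G X r H)"
    unfolding ConjMinLenSL_eq[OF assms(5) subgroup.subset[OF assms(7)]]
    by (intro regular_language_Int regular_language_compl regular_lex_reducible)
  ultimately show ?thesis ..
qed

end
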